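(* Let $m_1<m_2<m_3<m_4$ be positive integers with $\gcd\{m_1,m_2,m_3,m_4\}=1$ (so $n=4$). Then $K[\mathcal{C}]$ is a Koszul algebra if and only if $\{m_1,m_2,m_3,m_4\}$ is one of the following: $\{1,2,3,4\}$, $\{1,2,3,5\}$, $\{1,2,3,6\}$, $\{1,2,4,6\}$, $\{1,2,4,8\}$, $\{2,3,4,5\}$, $\{2,3,4,6\}$, $\{2,3,4,8\}$, $\{2,4,5,6\}$, $\{2,4,5,8\}$, $\{3,4,5,6\}$, $\{3,4,6,8\}$, $\{4,5,6,8\}$ or $\{4,6,7,8\}$.
   Context: $K$ is an infinite field and $R=K[x_1,\ldots,x_{n+1}]$ with its standard grading, here with $n=4$. For positive integers $m_1<\cdots<m_n$, the associated projective monomial curve $\mathcal{C}\subset\mathbb{P}^n_K$ is parametrically defined by $x_i=u^{m_i}v^{m_n-m_i}$ for $1\le i\le n$ and $x_{n+1}=v^{m_n}$. Its vanishing ideal $I(\mathcal{C})\subset R$ is the kernel of the $K$-algebra homomorphism $R\to K[u,v]$, $x_i\mapsto u^{m_i}v^{m_n-m_i}$ ($1\le i\le n$), $x_{n+1}\mapsto v^{m_n}$, and $K[\mathcal{C}]=R/I(\mathcal{C})$. $K[\mathcal{C}]$ is a Koszul algebra if its residue class field $K$ has a linear free resolution as a $K[\mathcal{C}]$-module. *)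

theory Defs
  imports "HOL-Algebra.QuotRing" "HOL-Algebra.Module" "HOL-Library.Poly_Mapping"
begin

section \<open>Graded modules and Koszul algebras\<close>

text \<open>A grading of a ring or module is given by the family of its homogeneous components, indexed
  by \<^typ>\<open>int\<close> so that all shifts make sense; the components of the graded algebras below vanish in
  negative degrees.\<close>

definition quot_grading :: "('a, 'm) ring_scheme \<Rightarrow> (int \<Rightarrow> 'a set) \<Rightarrow> 'a set \<Rightarrow> int \<Rightarrow> 'a set set"
  where "quot_grading A gr J d = (\<lambda>a. J +>\<^bsub>A\<^esub> a) ` gr d"

text \<open>The ring fields \<open>mult\<close> and \<open>one\<close> of a module record are not part of the module structure.\<close>

definition quot_module :: "('a, 'm) ring_scheme \<Rightarrow> 'a set \<Rightarrow> ('a, 'a set) module"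
  where "quot_module A J =
    \<lparr>carrier = carrier (A Quot J),
     mult = mult (A Quot J), one = one (A Quot J),
     zero = zero (A Quot J), add = add (A Quot J),
     smult = (\<lambda>a X. (J +>\<^bsub>A\<^esub> a) \<otimes>\<^bsub>A Quot J\<^esub> X)\<rparr>"

definition free_module :: "('a, 'm) ring_scheme \<Rightarrow> nat \<Rightarrow> ('a, nat \<Rightarrow> 'a) module"
  where "free_module A b =
    \<lparr>carrier = {..<b} \<rightarrow>\<^sub>E carrier A,
     mult = undefined, one = undefined,
     zero = (\<lambda>j\<in>{..<b}. \<zero>\<^bsub>A\<^esub>),
     add = (\<lambda>v w. \<lambda>j\<in>{..<b}. v j \<oplus>\<^bsub>A\<^esub> w j),
     smult = (\<lambda>a v. \<lambda>j\<in>{..<b}. a \<otimes>\<^bsub>A\<^esub> v j)\<rparr>"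

text \<open>The grading of \<open>A(-s)\<^sup>b\<close>, where \<open>A(-s)\<close> has \<open>A\<close> in degree \<open>d - s\<close> as its component of degree \<open>d\<close>.\<close>

definition shifted_free_grading :: "(int \<Rightarrow> 'a set) \<Rightarrow> nat \<Rightarrow> nat \<Rightarrow> int \<Rightarrow> (nat \<Rightarrow> 'a) set"
  where "shifted_free_grading gr s b d = {..<b} \<rightarrow>\<^sub>E gr (d - int s)"

definition graded_module_hom ::
  "('a, 'm) ring_scheme \<Rightarrow> ('a, 'b, 'p) module_scheme \<Rightarrow> (int \<Rightarrow> 'b set) \<Rightarrow>
   ('a, 'c, 'q) module_scheme \<Rightarrow> (int \<Rightarrow> 'c set) \<Rightarrow> ('b \<Rightarrow> 'c) set"
  where "graded_module_hom A M grM N grN =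
    {h \<in> carrier M \<rightarrow> carrier N.
       (\<forall>x\<in>carrier M. \<forall>y\<in>carrier M. h (x \<oplus>\<^bsub>M\<^esub> y) = h x \<oplus>\<^bsub>N\<^esub> h y) \<and>
       (\<forall>a\<in>carrier A. \<forall>x\<in>carrier M. h (a \<odot>\<^bsub>M\<^esub> x) = a \<odot>\<^bsub>N\<^esub> h x) \<and>
       (\<forall>d. h ` grM d \<subseteq> grN d)}"

text \<open>A linear free resolution of \<open>M\<close> (generated in degree 0) is an exact sequence of graded modules
  \<open>\<cdots> \<rightarrow> A(-2)\<^sup>b\<^sup>2 \<rightarrow> A(-1)\<^sup>b\<^sup>1 \<rightarrow> A\<^sup>b\<^sup>0 \<rightarrow> M \<rightarrow> 0\<close>
  with homomorphisms of degree 0; here \<open>D i\<close> is the map \<open>A(-i-1)\<^sup>b\<^sup>(\<^sup>i\<^sup>+\<^sup>1\<^sup>) \<rightarrow> A(-i)\<^sup>b\<^sup>i\<close> and \<open>e\<close> the augmentation.\<close>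

definition linear_free_resolution ::
  "('a, 'm) ring_scheme \<Rightarrow> (int \<Rightarrow> 'a set) \<Rightarrow> ('a, 'b, 'p) module_scheme \<Rightarrow> (int \<Rightarrow> 'b set) \<Rightarrow>
   (nat \<Rightarrow> nat) \<Rightarrow> (nat \<Rightarrow> (nat \<Rightarrow> 'a) \<Rightarrow> (nat \<Rightarrow> 'a)) \<Rightarrow> ((nat \<Rightarrow> 'a) \<Rightarrow> 'b) \<Rightarrow> bool"
  where "linear_free_resolution A gr M grM b D e \<longleftrightarrow>
    e \<in> graded_module_hom A (free_module A (b 0)) (shifted_free_grading gr 0 (b 0)) M grM \<and>
    (\<forall>i. D i \<in> graded_module_hom A
           (free_module A (b (Suc i))) (shifted_free_grading gr (Suc i) (b (Suc i)))
           (free_module A (b i)) (shifted_free_grading gr i (b i))) \<and>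
    e ` carrier (free_module A (b 0)) = carrier M \<and>
    D 0 ` carrier (free_module A (b 1)) = a_kernel (free_module A (b 0)) M e \<and>
    (\<forall>i. D (Suc i) ` carrier (free_module A (b (Suc (Suc i))))
          = a_kernel (free_module A (b (Suc i))) (free_module A (b i)) (D i))"

definition has_linear_free_resolution ::
  "('a, 'm) ring_scheme \<Rightarrow> (int \<Rightarrow> 'a set) \<Rightarrow> ('a, 'b, 'p) module_scheme \<Rightarrow> (int \<Rightarrow> 'b set) \<Rightarrow> bool"
  where "has_linear_free_resolution A gr M grM \<longleftrightarrow>
    (\<exists>b D e. linear_free_resolution A gr M grM b D e)"

definition irrelevant_ideal :: "('a, 'm) ring_scheme \<Rightarrow> (int \<Rightarrow> 'a set) \<Rightarrow> 'a set"
  where "irrelevant_ideal A gr = Idl\<^bsub>A\<^esub> (\<Union>d\<in>{0<..}. gr d)"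

text \<open>Meant for a standard graded algebra \<open>A\<close> over a field \<open>K\<close>, whose residue class field is
  \<open>A/A\<^sub>+ = K\<close>, concentrated in degree 0.\<close>

definition koszul_algebra :: "('a, 'm) ring_scheme \<Rightarrow> (int \<Rightarrow> 'a set) \<Rightarrow> bool"
  where "koszul_algebra A gr \<longleftrightarrow>
    has_linear_free_resolution A gr
      (quot_module A (irrelevant_ideal A gr)) (quot_grading A gr (irrelevant_ideal A gr))"


section \<open>Polynomial rings\<close>

text \<open>Polynomials in variables indexed by \<^typ>\<open>nat\<close>: finitely supported coefficient functions on
  monomials, which in turn are finitely supported exponent functions.\<close>

type_synonym 'k mpoly = "(nat \<Rightarrow>\<^sub>0 nat) \<Rightarrow>\<^sub>0 'k"

definition mconst :: "'k::field \<Rightarrow> 'k mpoly"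
  where "mconst c = Poly_Mapping.single 0 c"

definition mvar :: "nat \<Rightarrow> 'k::field mpoly"
  where "mvar i = Poly_Mapping.single (Poly_Mapping.single i 1) 1"

text \<open>\<open>K[x\<^sub>1,\<dots>,x\<^sub>N]\<close> with its standard grading.\<close>

definition mpoly_ring :: "nat \<Rightarrow> 'k::field mpoly ring"
  where "mpoly_ring N =
    \<lparr>carrier = {p. \<forall>t\<in>Poly_Mapping.keys p. Poly_Mapping.keys t \<subseteq> {1..N}},
     mult = (*), one = 1, zero = 0, add = (+)\<rparr>"

definition monom_degree :: "(nat \<Rightarrow>\<^sub>0 nat) \<Rightarrow> nat"
  where "monom_degree t = (\<Sum>i\<in>Poly_Mapping.keys t. Poly_Mapping.lookup t i)"

definition mpoly_grading :: "nat \<Rightarrow> int \<Rightarrow> 'k::field mpoly set"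
  where "mpoly_grading N d =
    {p \<in> carrier (mpoly_ring N). \<forall>t\<in>Poly_Mapping.keys p. int (monom_degree t) = d}"

text \<open>The \<open>K\<close>-algebra homomorphism with \<open>x\<^sub>i \<mapsto> f i\<close>.\<close>

definition mpoly_subst :: "(nat \<Rightarrow> 'k::field mpoly) \<Rightarrow> 'k mpoly \<Rightarrow> 'k mpoly"
  where "mpoly_subst f p =
    (\<Sum>t\<in>Poly_Mapping.keys p. mconst (Poly_Mapping.lookup p t) *
       (\<Prod>i\<in>Poly_Mapping.keys t. f i ^ Poly_Mapping.lookup t i))"


section \<open>Projective monomial curves\<close>

text \<open>\<open>K[u,v]\<close> is \<^term>\<open>mpoly_ring 2\<close>, with \<open>u\<close> and \<open>v\<close> its first and second variable.\<close>

definition curve_param :: "nat \<Rightarrow> (nat \<Rightarrow> nat) \<Rightarrow> nat \<Rightarrow> 'k::field mpoly"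
  where "curve_param n m i =
    (if i = n + 1 then mvar 2 ^ m n else mvar 1 ^ m i * mvar 2 ^ (m n - m i))"

definition curve_ideal :: "nat \<Rightarrow> (nat \<Rightarrow> nat) \<Rightarrow> 'k::field mpoly set"
  where "curve_ideal n m =
    a_kernel (mpoly_ring (n + 1)) (mpoly_ring 2) (mpoly_subst (curve_param n m))"

definition curve_ring :: "nat \<Rightarrow> (nat \<Rightarrow> nat) \<Rightarrow> 'k::field mpoly set ring"
  where "curve_ring n m = mpoly_ring (n + 1) Quot curve_ideal n m"

definition curve_ring_grading :: "nat \<Rightarrow> (nat \<Rightarrow> nat) \<Rightarrow> int \<Rightarrow> 'k::field mpoly set set"
  where "curve_ring_grading n m =
    quot_grading (mpoly_ring (n + 1)) (mpoly_grading (n + 1)) (curve_ideal n m)"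

end

theory Submission
  imports Defs
begin

text \<open>The coordinate ring of the curve is the semigroup algebra of the semigroup \<open>S\<close> generated by the
  vectors \<open>(w, M - w)\<close>, where \<open>M = m\<^sub>4\<close> and \<open>w\<close> runs through \<open>0, m\<^sub>1, m\<^sub>2, m\<^sub>3, m\<^sub>4\<close>.

  If the algebra is Koszul, the syzygies of its five generators are linear, and this forces the
  factorizations of every element of \<open>S\<close> of degree at least 3 to be connected through common factors.
  Applied to the least \<open>k\<close> such that \<open>k\<close> times a generator \<open>(m\<^sub>i, M - m\<^sub>i)\<close> has a second factorization,
  this yields \<open>k = 2\<close>, that is, \<open>2 m\<^sub>i = w + w'\<close> with \<open>w, w' \<noteq> m\<^sub>i\<close>, for \<open>i = 1, 2, 3\<close>. These linear equations have only sixteen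
  coprime solutions, and two of them, \<open>{1, 2, 4, 7}\<close> and \<open>{3, 5, 6, 7}\<close>, have a disconnected element of degree 3:
  \<open>0 + 0 + 7 = 1 + 2 + 4\<close> and \<open>0 + 7 + 7 = 3 + 5 + 6\<close>.

  Conversely, each of the fourteen remaining algebras has a Koszul filtration consisting of a full flag
  of ideals generated by variables. Modules with a generating sequence whose successive colon
  ideals belong to a Koszul filtration are closed under taking (linear) syzygies, which gives the linear
  resolution.\<close>


section \<open>Graded affine semigroups and their algebras\<close>

text \<open>Swapping \<open>u\<close> and \<open>v\<close> replaces each weight \<open>w\<close> by
  \<open>M - w\<close>, and the list is stable under this: it consists of six mirror pairs and the
  self-mirror sets {1, 2, 3, 4} and {2, 3, 4, 6}. The two rejected candidates mirror each other.
  Connectedness in degrees at least 3 is the combinatorial face of the fact that Koszul algebras are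
  quadratic: disconnected factorizations of an element mean a minimal generator of the toric ideal
  in that degree. It is extracted here from the second differential. The obstacle is that a given
  resolution comes with arbitrary ranks and bases, so its linear forms must be compared with the
  variables by scalar matrices. In the other direction an infinite resolution has to come from
  finite data. A Koszul filtration contains all the colon ideals that arise, so one flag serves
  every homological degree. As the ideals are monomial, the colon conditions concern only pairs
  \<open>(w, d)\<close>, and the description of the semigroup by gaps turns them into linear integer
  arithmetic.\<close>

lemma poly_mapping_eq_sum_single:
  "p = (\<Sum>s\<in>Poly_Mapping.keys p. Poly_Mapping.single s (Poly_Mapping.lookup p s))"
  by (rule poly_mapping_eqI) (auto simp: lookup_sum lookup_single when_def in_keys_iff)

lemma single_sum: "Poly_Mapping.single s (sum f I) = (\<Sum>i\<in>I. Poly_Mapping.single s (f i))"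
  by (induction I rule: infinite_finite_induct) (auto simp: single_add)

lemma lookup_single_0_mult: "Poly_Mapping.lookup (Poly_Mapping.single 0 c * p) s = c * Poly_Mapping.lookup p s"
proof -
  have "Poly_Mapping.single 0 c * p = (\<Sum>s\<in>Poly_Mapping.keys p. Poly_Mapping.single s (c * Poly_Mapping.lookup p s))"
    by (subst poly_mapping_eq_sum_single[of p]) (simp add: sum_distrib_left mult_single)
  then show ?thesis
    by (auto simp: lookup_sum lookup_single when_def in_keys_iff)
qed

text \<open>The cancellative type class makes translation by \<open>at t\<close> injective, so
  multiplication by a variable merely shifts supports. \<open>inj_at\<close> makes distinct indices
  give distinct, hence linearly independent, variables.\<close>

locale graded_semigroup =
  fixes S :: "'g::cancel_comm_monoid_add set" and W :: "nat set" and at :: "nat \<Rightarrow> 'g"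
    and deg :: "'g \<Rightarrow> nat"
  assumes finite_W: "finite W"
    and inj_at: "inj_on at W"
    and zero_in: "0 \<in> S"
    and add_in: "s \<in> S \<Longrightarrow> t \<in> S \<Longrightarrow> s + t \<in> S"
    and at_in: "w \<in> W \<Longrightarrow> at w \<in> S"
    and deg_add: "s \<in> S \<Longrightarrow> t \<in> S \<Longrightarrow> deg (s + t) = deg s + deg t"
    and deg_at: "w \<in> W \<Longrightarrow> deg (at w) = 1"
    and decompose: "s \<in> S \<Longrightarrow> s \<noteq> 0 \<Longrightarrow> \<exists>w\<in>W. \<exists>s'\<in>S. s = at w + s'"
begin

lemma deg_zero: "deg 0 = 0"
  using deg_add[OF zero_in zero_in] by simp

lemma deg_eq_0: "s \<in> S \<Longrightarrow> deg s = 0 \<longleftrightarrow> s = 0"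
  using decompose[of s] deg_add at_in deg_at deg_zero by fastforce

lemma deg_eq_1: "s \<in> S \<Longrightarrow> deg s = 1 \<Longrightarrow> \<exists>w\<in>W. s = at w"
  using decompose[of s] deg_add at_in deg_at deg_zero deg_eq_0
  by (metis One_nat_def Suc_eq_plus1_left add.right_neutral add_diff_cancel_left' zero_neq_one)

definition sring :: "('g \<Rightarrow>\<^sub>0 'k::field) set"
  where "sring = {q. Poly_Mapping.keys q \<subseteq> S}"

definition scomp :: "nat \<Rightarrow> ('g \<Rightarrow>\<^sub>0 'k::field) set"
  where "scomp d = {q. Poly_Mapping.keys q \<subseteq> {s \<in> S. deg s = d}}"

definition divisible :: "nat set \<Rightarrow> 'g set"
  where "divisible T = {at t + s | t s. t \<in> T \<and> s \<in> S}"

text \<open>For \<open>T \<subseteq> W\<close> this is the ideal generated by the variables in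
  \<open>T\<close>. Describing it by supports reduces membership to divisibility in
  \<open>S\<close>; generation by the variables is the content of
  \<open>mideal_insert\<close>.\<close>

definition mideal :: "nat set \<Rightarrow> ('g \<Rightarrow>\<^sub>0 'k::field) set"
  where "mideal T = {q. Poly_Mapping.keys q \<subseteq> divisible T}"

definition X :: "nat \<Rightarrow> ('g \<Rightarrow>\<^sub>0 'k::field)"
  where "X w = Poly_Mapping.single (at w) 1"

lemma sring_0 [simp]: "0 \<in> sring"
  by (simp add: sring_def)

lemma sring_add: "p \<in> sring \<Longrightarrow> q \<in> sring \<Longrightarrow> p + q \<in> sring"
  using Poly_Mapping.keys_add[of p q] by (auto simp: sring_def)

lemma sring_uminus: "p \<in> sring \<Longrightarrow> - p \<in> sring"
  by (simp add: sring_def)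

lemma sring_diff: "p \<in> sring \<Longrightarrow> q \<in> sring \<Longrightarrow> p - q \<in> sring"
  using sring_add[of p "- q"] sring_uminus[of q] by simp

lemma sring_mult: "p \<in> sring \<Longrightarrow> q \<in> sring \<Longrightarrow> p * q \<in> sring"
  using Poly_Mapping.keys_mult[of p q] add_in by (fastforce simp: sring_def)

lemma sring_sum: "(\<And>i. i \<in> I \<Longrightarrow> f i \<in> sring) \<Longrightarrow> sum f I \<in> sring"
  by (induction I rule: infinite_finite_induct) (auto intro: sring_add)

lemma scomp_0 [simp]: "0 \<in> scomp d"
  by (simp add: scomp_def)

lemma scomp_add: "p \<in> scomp d \<Longrightarrow> q \<in> scomp d \<Longrightarrow> p + q \<in> scomp d"
  using Poly_Mapping.keys_add[of p q] by (auto simp: scomp_def)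

lemma scomp_uminus: "p \<in> scomp d \<Longrightarrow> - p \<in> scomp d"
  by (simp add: scomp_def)

lemma scomp_mult: "p \<in> scomp d \<Longrightarrow> q \<in> scomp e \<Longrightarrow> p * q \<in> scomp (d + e)"
  using Poly_Mapping.keys_mult[of p q] add_in deg_add by (fastforce simp: scomp_def)

lemma scomp_sum: "(\<And>i. i \<in> I \<Longrightarrow> f i \<in> scomp d) \<Longrightarrow> sum f I \<in> scomp d"
  by (induction I rule: infinite_finite_induct) (auto intro: scomp_add)

lemma scomp_imp_sring: "p \<in> scomp d \<Longrightarrow> p \<in> sring"
  by (auto simp: scomp_def sring_def)

lemma X_scomp: "w \<in> W \<Longrightarrow> X w \<in> scomp 1"
  by (auto simp: X_def scomp_def at_in deg_at)

lemma X_sring: "w \<in> W \<Longrightarrow> X w \<in> sring"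
  using X_scomp scomp_imp_sring by blast

lemma mideal_0 [simp]: "0 \<in> mideal T"
  by (simp add: mideal_def)

lemma mideal_add: "p \<in> mideal T \<Longrightarrow> q \<in> mideal T \<Longrightarrow> p + q \<in> mideal T"
  using Poly_Mapping.keys_add[of p q] by (auto simp: mideal_def)

lemma mideal_sum: "(\<And>i. i \<in> I \<Longrightarrow> f i \<in> mideal T) \<Longrightarrow> sum f I \<in> mideal T"
  by (induction I rule: infinite_finite_induct) (auto intro: mideal_add)

lemma divisible_add: "s \<in> divisible T \<Longrightarrow> t \<in> S \<Longrightarrow> t + s \<in> divisible T"
  unfolding divisible_def using add_in by (auto simp: add_ac) (metis add.assoc add.commute add_in)

lemma mideal_mult: "p \<in> sring \<Longrightarrow> q \<in> mideal T \<Longrightarrow> p * q \<in> mideal T"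
  using Poly_Mapping.keys_mult[of p q] divisible_add
  by (fastforce simp: sring_def mideal_def)

lemma mideal_empty: "mideal {} = {0}"
  by (auto simp: mideal_def divisible_def)

lemma mideal_mono: "T \<subseteq> T' \<Longrightarrow> mideal T \<subseteq> mideal T'"
  unfolding mideal_def divisible_def by blast

lemma X_mideal: "t \<in> T \<Longrightarrow> X t \<in> mideal T"
  using zero_in by (force simp: mideal_def divisible_def X_def intro: exI[of _ t] bexI[of _ 0])

text \<open>Each monomial of an element is divisible by a variable in \<open>T\<close> or is a
  multiple of \<open>X t\<close>, and the right-hand side is closed under sums, so the terms can be
  treated one at a time.\<close>

lemma mideal_insert:
  "(mideal (insert t T) :: ('g \<Rightarrow>\<^sub>0 'k::field) set) = {p + c * X t | p c. p \<in> mideal T \<and> c \<in> sring}"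
  if "t \<in> W"
proof (intro equalityI subsetI)
  fix q :: "'g \<Rightarrow>\<^sub>0 'k" assume "q \<in> {p + c * X t | p c. p \<in> mideal T \<and> c \<in> sring}"
  then show "q \<in> mideal (insert t T)"
    using mideal_mono[of T "insert t T"] X_mideal[of t "insert t T"]
    by (auto intro!: mideal_add mideal_mult)
next
  define Q :: "('g \<Rightarrow>\<^sub>0 'k) set" where "Q = {p + c * X t | p c. p \<in> mideal T \<and> c \<in> sring}"
  have Q_sum: "sum f I \<in> Q" if "\<And>i. i \<in> I \<Longrightarrow> f i \<in> Q" for f and I :: "'g set"
    using that
  proof (induction I rule: infinite_finite_induct)
    case (insert x F)
    then obtain p c p' c' where
      "f x = p + c * X t" "p \<in> mideal T" "c \<in> sring"
      "sum f F = p' + c' * X t" "p' \<in> mideal T" "c' \<in> sring"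
      by (force simp: Q_def)
    with insert have "sum f (insert x F) = (p + p') + (c + c') * X t"
      by (simp add: algebra_simps)
    then show ?case
      unfolding Q_def using mideal_add sring_add \<open>p \<in> mideal T\<close> \<open>p' \<in> mideal T\<close> \<open>c \<in> sring\<close> \<open>c' \<in> sring\<close>
      by blast
  qed (auto simp: Q_def intro!: exI[of _ 0])
  fix q :: "'g \<Rightarrow>\<^sub>0 'k" assume q: "q \<in> mideal (insert t T)"
  have "Poly_Mapping.single s (Poly_Mapping.lookup q s) \<in> Q" if "s \<in> Poly_Mapping.keys q" for s
  proof (cases "s \<in> divisible T")
    case True
    then have "Poly_Mapping.single s (Poly_Mapping.lookup q s) \<in> mideal T"
      by (simp add: mideal_def)
    then show ?thesis
      unfolding Q_def by (force intro: exI[of _ 0])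
  next
    case False
    with that q obtain s' where "s = at t + s'" "s' \<in> S"
      by (auto simp: mideal_def divisible_def)
    then have "Poly_Mapping.single s (Poly_Mapping.lookup q s)
        = 0 + Poly_Mapping.single s' (Poly_Mapping.lookup q s) * X t"
      by (simp add: X_def mult_single add_ac)
    moreover have "Poly_Mapping.single s' (Poly_Mapping.lookup q s) \<in> sring"
      using \<open>s' \<in> S\<close> by (simp add: sring_def)
    ultimately show ?thesis
      unfolding Q_def by (metis (mono_tags, lifting) mem_Collect_eq mideal_0)
  qed
  then have "q \<in> Q"
    using Q_sum poly_mapping_eq_sum_single[of q] by metis
  then show "q \<in> {p + c * X t | p c. p \<in> mideal T \<and> c \<in> sring}"
    by (simp add: Q_def)
qed

lemma keys_mult_X: "Poly_Mapping.keys (c * X t) = (+) (at t) ` Poly_Mapping.keys c"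
proof -
  have lk: "Poly_Mapping.lookup (c * X t) (at t + s) = Poly_Mapping.lookup c s" for s
  proof -
    have "c * X t = (\<Sum>s\<in>Poly_Mapping.keys c. Poly_Mapping.single (at t + s) (Poly_Mapping.lookup c s))"
      by (subst poly_mapping_eq_sum_single[of c])
        (simp add: sum_distrib_right X_def mult_single add_ac)
    then show ?thesis
      by (auto simp: lookup_sum lookup_single when_def in_keys_iff)
  qed
  have "Poly_Mapping.keys (c * X t) \<subseteq> (+) (at t) ` Poly_Mapping.keys c"
    using Poly_Mapping.keys_mult[of c "X t"] by (auto simp: X_def add_ac)
  then show ?thesis
    using lk by (auto simp: in_keys_iff)
qed

section \<open>Colon ideals by a variable\<close>

definition colon :: "nat set \<Rightarrow> nat \<Rightarrow> nat set \<Rightarrow> bool"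
  where "colon T t T' \<longleftrightarrow> (\<forall>s\<in>S. at t + s \<in> divisible T \<longleftrightarrow> s \<in> divisible T')"

lemma mideal_subset_sring: "T \<subseteq> W \<Longrightarrow> mideal T \<subseteq> sring"
  using at_in add_in by (fastforce simp: mideal_def sring_def divisible_def)

text \<open>The support of \<open>c * X t\<close> is a translate of the support of \<open>c\<close>,
  so the colon ideal is monomial and can be read off from monomials alone.\<close>

lemma colon_mideal:
  assumes "colon T t T'" "T' \<subseteq> W"
  shows "{c \<in> sring. c * X t \<in> mideal T} = (mideal T' :: ('g \<Rightarrow>\<^sub>0 'k::field) set)"
proof -
  have "c * X t \<in> mideal T \<longleftrightarrow> c \<in> mideal T'" if "c \<in> sring" for c :: "'g \<Rightarrow>\<^sub>0 'k"
    using that assms(1) by (auto simp: mideal_def keys_mult_X colon_def sring_def image_subset_iff subset_iff)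
  then show ?thesis
    using mideal_subset_sring[OF assms(2)] by auto
qed

section \<open>Koszul filtrations\<close>

text \<open>Vectors are functions on all natural numbers, so one type serves free modules of every
  rank; the vectors of the resolution vanish beyond the rank.\<close>

definition span :: "(nat \<Rightarrow> ('g \<Rightarrow>\<^sub>0 'k::field)) list \<Rightarrow> (nat \<Rightarrow> ('g \<Rightarrow>\<^sub>0 'k)) set"
  where "span G = {v. \<exists>c. (\<forall>k<length G. c k \<in> sring) \<and> v = (\<lambda>i. \<Sum>k<length G. c k * (G ! k) i)}"

lemma spanI: "(\<And>k. k < length G \<Longrightarrow> c k \<in> sring) \<Longrightarrow> (\<lambda>i. \<Sum>k<length G. c k * (G ! k) i) \<in> span G"
  unfolding span_def by (rule CollectI, rule exI[of _ c]) simp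

lemma span_Nil: "span [] = {\<lambda>i. 0}"
  by (auto simp: span_def)

lemma span_snoc: "span (G @ [g]) = {v. \<exists>u\<in>span G. \<exists>c\<in>sring. v = (\<lambda>i. u i + c * g i)}"
proof (intro equalityI subsetI)
  fix v assume "v \<in> span (G @ [g])"
  then obtain c where c: "\<forall>k<Suc (length G). c k \<in> sring"
      "v = (\<lambda>i. \<Sum>k<Suc (length G). c k * ((G @ [g]) ! k) i)"
    by (auto simp: span_def)
  have "v = (\<lambda>i. (\<Sum>k<length G. c k * (G ! k) i) + c (length G) * g i)"
    by (simp add: c(2) nth_append)
  moreover have "(\<lambda>i. \<Sum>k<length G. c k * (G ! k) i) \<in> span G"
    using c(1) by (intro spanI) simp
  ultimately show "v \<in> {v. \<exists>u\<in>span G. \<exists>c\<in>sring. v = (\<lambda>i. u i + c * g i)}"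
    using c(1) by (intro CollectI bexI[of _ "\<lambda>i. \<Sum>k<length G. c k * (G ! k) i"] bexI[of _ "c (length G)"]) auto
next
  fix v assume "v \<in> {v. \<exists>u\<in>span G. \<exists>c\<in>sring. v = (\<lambda>i. u i + c * g i)}"
  then obtain c a where c: "\<forall>k<length G. c k \<in> sring" "a \<in> sring"
      "v = (\<lambda>i. (\<Sum>k<length G. c k * (G ! k) i) + a * g i)"
    by (auto simp: span_def)
  then have "v = (\<lambda>i. \<Sum>k<Suc (length G). (c(length G := a)) k * ((G @ [g]) ! k) i)"
    by (simp add: nth_append)
  moreover have "\<forall>k<Suc (length G). (c(length G := a)) k \<in> sring"
    using c by (simp add: less_Suc_eq)
  ultimately show "v \<in> span (G @ [g])"
    using spanI[of "G @ [g]" "c(length G := a)"] by (simp del: fun_upd_apply)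
qed

definition submod :: "(nat \<Rightarrow> ('g \<Rightarrow>\<^sub>0 'k::field)) set \<Rightarrow> bool"
  where "submod U \<longleftrightarrow> (\<forall>u\<in>U. \<forall>v\<in>U. (\<lambda>i. u i + v i) \<in> U) \<and> (\<forall>c\<in>sring. \<forall>u\<in>U. (\<lambda>i. c * u i) \<in> U)"

definition linear_quotients :: "nat set set \<Rightarrow> (nat \<Rightarrow> ('g \<Rightarrow>\<^sub>0 'k::field)) list \<Rightarrow> bool"
  where "linear_quotients F G \<longleftrightarrow>
    (\<forall>k<length G. \<exists>T\<in>F. {a \<in> sring. (\<lambda>i. a * (G ! k) i) \<in> span (take k G)} = mideal T)"

lemma linear_quotients_snoc:
  "linear_quotients F (G @ [g]) \<longleftrightarrow>
    linear_quotients F G \<and> (\<exists>T\<in>F. {a \<in> sring. (\<lambda>i. a * g i) \<in> span G} = mideal T)"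
  by (auto simp: linear_quotients_def nth_append less_Suc_eq)

text \<open>The colon condition of a Koszul filtration, stated along a whole chain of
  generators.\<close>

definition good_order :: "nat set set \<Rightarrow> nat list \<Rightarrow> bool"
  where "good_order F ts \<longleftrightarrow> set ts \<subseteq> W \<and>
    (\<forall>j<length ts. \<exists>T\<in>F. T \<subseteq> W \<and> colon (set (take j ts)) (ts ! j) T)"

lemma good_order_snoc:
  "good_order F (ts @ [t]) \<longleftrightarrow> good_order F ts \<and> t \<in> W \<and> (\<exists>T\<in>F. T \<subseteq> W \<and> colon (set ts) t T)"
  by (auto simp: good_order_def nth_append less_Suc_eq)

text \<open>\<open>H\<close> generates the kernel of the coordinate \<open>k\<close> on
  \<open>U\<close>, and the \<open>\<sigma> t\<close> lift the variables. At each stage the span is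
  cut out of \<open>U\<close> by a condition on coordinate \<open>k\<close> alone, so
  \<open>a\<close> times \<open>\<sigma> t\<close> lies in it exactly when \<open>a * X t\<close>
  lies in the ideal of the earlier variables: the colon ideals of the module are those of the
  flag.\<close>

lemma extend_linear_quotients:
  assumes "submod U"
    and "span H = {u \<in> U. u k = 0}"
    and "linear_quotients F H"
    and "good_order F ts"
    and "\<And>t. t \<in> set ts \<Longrightarrow> \<sigma> t \<in> U \<and> \<sigma> t k = X t"
  shows "span (H @ map \<sigma> ts) = {u \<in> U. u k \<in> mideal (set ts)} \<and> linear_quotients F (H @ map \<sigma> ts)"
  using assms(4,5)
proof (induction ts rule: rev_induct)
  case Nil
  then show ?case
    using assms(2,3) by (simp add: mideal_empty)
next
  case (snoc t ts)
  let ?H = "H @ map \<sigma> ts"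
  from snoc have IH: "span ?H = {u \<in> U. u k \<in> mideal (set ts)}" "linear_quotients F ?H"
    by (auto simp: good_order_snoc)
  from snoc have t: "t \<in> W" "\<sigma> t \<in> U" "\<sigma> t k = X t"
    by (auto simp: good_order_snoc)
  have scal: "(\<lambda>i. c * u i) \<in> U" if "c \<in> sring" "u \<in> U" for c u
    using that assms(1) by (auto simp: submod_def)
  have plus: "(\<lambda>i. v i + u i) \<in> U" if "v \<in> U" "u \<in> U" for v u
    using that assms(1) by (auto simp: submod_def)
  from snoc.prems(1) obtain T where T: "T \<in> F" "T \<subseteq> W" "colon (set ts) t T"
    by (auto simp: good_order_snoc)
  have "{a \<in> sring. (\<lambda>i. a * \<sigma> t i) \<in> span ?H} = {a \<in> sring. a * X t \<in> mideal (set ts)}"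
    using IH(1) t scal by auto
  then have lq: "linear_quotients F (?H @ [\<sigma> t])"
    unfolding linear_quotients_snoc using IH(2) T colon_mideal[OF T(3,2)] by blast
  have "span (?H @ [\<sigma> t]) = {u \<in> U. u k \<in> mideal (set (ts @ [t]))}"
  proof (intro equalityI subsetI)
    fix v assume "v \<in> span (?H @ [\<sigma> t])"
    then obtain u c where "u \<in> U" "u k \<in> mideal (set ts)" "c \<in> sring" "v = (\<lambda>i. u i + c * \<sigma> t i)"
      unfolding span_snoc IH(1) by auto
    then show "v \<in> {u \<in> U. u k \<in> mideal (set (ts @ [t]))}"
      using plus scal t by (auto simp: mideal_insert)
  next
    fix v assume "v \<in> {u \<in> U. u k \<in> mideal (set (ts @ [t]))}"
    then obtain p c where pc: "v \<in> U" "v k = p + c * X t" "p \<in> mideal (set ts)" "c \<in> sring"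
      using t by (auto simp: mideal_insert)
    define u where "u = (\<lambda>i. v i + (- c) * \<sigma> t i)"
    have "u \<in> U"
      unfolding u_def using pc t by (intro plus scal sring_uminus)
    moreover have "u k = p"
      using pc t by (simp add: u_def)
    ultimately have "u \<in> span ?H"
      using IH(1) pc by auto
    moreover have "v = (\<lambda>i. u i + c * \<sigma> t i)"
      by (simp add: u_def)
    ultimately show "v \<in> span (?H @ [\<sigma> t])"
      unfolding span_snoc using pc by blast
  qed
  with lq show ?case
    by simp
qed

section \<open>Homogeneous components and syzygies\<close>

definition hcomp :: "nat \<Rightarrow> ('g \<Rightarrow>\<^sub>0 'k::field) \<Rightarrow> ('g \<Rightarrow>\<^sub>0 'k)"
  where "hcomp d p = Poly_Mapping.mapp (\<lambda>s c. if deg s = d then c else 0) p"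

lemma lookup_hcomp: "Poly_Mapping.lookup (hcomp d p) s = (if deg s = d then Poly_Mapping.lookup p s else 0)"
  by (auto simp: hcomp_def lookup_mapp when_def in_keys_iff)

lemma hcomp_scomp: "p \<in> sring \<Longrightarrow> hcomp d p \<in> scomp d"
  by (auto simp: scomp_def sring_def in_keys_iff lookup_hcomp subset_iff split: if_splits)

lemma hcomp_id: "p \<in> scomp d \<Longrightarrow> hcomp d p = p"
  by (rule poly_mapping_eqI) (auto simp: lookup_hcomp scomp_def in_keys_iff subset_iff)

lemma hcomp_sum: "hcomp d (sum f I) = (\<Sum>i\<in>I. hcomp d (f i))"
  by (rule poly_mapping_eqI) (auto simp: lookup_hcomp lookup_sum)

lemma hcomp_mult:
  assumes p: "p \<in> sring" and q: "q \<in> scomp e"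
  shows "hcomp (d + e) (p * q) = hcomp d p * q"
proof (rule poly_mapping_eqI)
  fix s
  let ?r = "p - hcomp d p"
  have r: "?r \<in> sring" "\<And>s. s \<in> Poly_Mapping.keys ?r \<Longrightarrow> deg s \<noteq> d"
    using hcomp_scomp[OF p, of d] p scomp_imp_sring sring_diff
    by (auto simp: in_keys_iff lookup_minus lookup_hcomp)
  have *: "Poly_Mapping.lookup (?r * q) s = 0" if "deg s = d + e"
  proof (rule ccontr)
    assume "Poly_Mapping.lookup (?r * q) s \<noteq> 0"
    then obtain a b where ab: "s = a + b" "a \<in> Poly_Mapping.keys ?r" "b \<in> Poly_Mapping.keys q"
      using Poly_Mapping.keys_mult[of ?r q] by (auto simp: in_keys_iff)
    moreover from ab r(1) q have "a \<in> S" "b \<in> S" "deg b = e"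
      by (auto simp: sring_def scomp_def)
    ultimately show False
      using r(2) that deg_add by force
  qed
  have "p * q = hcomp d p * q + ?r * q"
    by (simp add: algebra_simps)
  then have 1: "Poly_Mapping.lookup (p * q) s
      = Poly_Mapping.lookup (hcomp d p * q) s + Poly_Mapping.lookup (?r * q) s"
    by (metis lookup_add)
  have 2: "Poly_Mapping.lookup (hcomp d p * q) s = 0" if "deg s \<noteq> d + e"
    using scomp_mult[OF hcomp_scomp[OF p] q] that by (fastforce simp: scomp_def in_keys_iff)
  show "Poly_Mapping.lookup (hcomp (d + e) (p * q)) s = Poly_Mapping.lookup (hcomp d p * q) s"
    using 1 2 * by (auto simp: lookup_hcomp)
qed

text \<open>Only the first \<open>b\<close> members of \<open>G\<close> take part, which permits
  induction on \<open>b\<close> through \<open>syz_Suc\<close>. The extension by zero makes a syzygy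
  a vector of the next stage.\<close>

definition syz :: "nat \<Rightarrow> (nat \<Rightarrow> ('g \<Rightarrow>\<^sub>0 'k::field)) list \<Rightarrow> (nat \<Rightarrow> ('g \<Rightarrow>\<^sub>0 'k)) set"
  where "syz b G = {v. (\<forall>k. v k \<in> sring) \<and> (\<forall>k\<ge>b. v k = 0) \<and> (\<forall>i. (\<Sum>k<b. v k * (G ! k) i) = 0)}"

lemma submod_syz: "submod (syz b G)"
proof -
  have "(\<Sum>k<b. c * u k * (G ! k) i) = c * (\<Sum>k<b. u k * (G ! k) i)" for c u i
    by (simp add: sum_distrib_left mult.assoc)
  then show ?thesis
    by (auto simp: submod_def syz_def distrib_right sum.distrib intro: sring_add sring_mult)
qed

lemma syz_Suc: "{u \<in> syz (Suc k) G. u k = 0} = syz k G"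
proof (intro equalityI subsetI)
  fix u assume "u \<in> {u \<in> syz (Suc k) G. u k = 0}"
  moreover from this have "u j = 0" if "j \<ge> k" for j
    using that by (cases "j = k") (auto simp: syz_def)
  ultimately show "u \<in> syz k G"
    by (auto simp: syz_def)
qed (auto simp: syz_def)

definition koszul_filtration :: "nat set set \<Rightarrow> bool"
  where "koszul_filtration F \<longleftrightarrow> W \<in> F \<and> (\<forall>T\<in>F. \<exists>ts. set ts = T \<and> good_order F ts)"

text \<open>The syzygies of \<open>G\<close> are filtered by their last nonzero coordinate; the coordinates that occur at
  position \<open>k\<close> form the \<open>k\<close>-th colon ideal of \<open>G\<close>, so lifting its generators extends a list with linear
  quotients.\<close>

lemma linear_syzygies:
  assumes F: "koszul_filtration F"
    and G: "linear_quotients F G" "\<And>g i. g \<in> set G \<Longrightarrow> g i \<in> scomp 1"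
  shows "\<exists>H. span H = syz (length G) G \<and> linear_quotients F H \<and> (\<forall>h\<in>set H. \<forall>i. h i \<in> scomp 1)"
proof -
  have "\<exists>H. span H = syz k G \<and> linear_quotients F H \<and> (\<forall>h\<in>set H. \<forall>i. h i \<in> scomp 1)"
    if "k \<le> length G" for k
    using that
  proof (induction k)
    case 0
    have "span [] = syz 0 G"
      by (auto simp: span_Nil syz_def)
    then show ?case
      by (intro exI[of _ "[]"]) (auto simp: linear_quotients_def)
  next
    case (Suc k)
    then obtain H where H: "span H = syz k G" "linear_quotients F H" "\<And>h i. h \<in> set H \<Longrightarrow> h i \<in> scomp 1"
      by auto
    from Suc.prems have k: "k < length G" by simp
    with G(1) obtain T where T: "T \<in> F" "{a \<in> sring. (\<lambda>i. a * (G ! k) i) \<in> span (take k G)} = mideal T"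
      by (auto simp: linear_quotients_def)
    from F T(1) obtain ts where ts: "set ts = T" "good_order F ts"
      by (auto simp: koszul_filtration_def)
    have "\<exists>\<sigma>. \<sigma> \<in> syz (Suc k) G \<and> \<sigma> k = X t \<and> (\<forall>i. \<sigma> i \<in> scomp 1)" if "t \<in> T" for t
    proof -
      have tW: "t \<in> W"
        using that ts by (auto simp: good_order_def)
      have "X t \<in> mideal T"
        using that by (rule X_mideal)
      with T(2) have "(\<lambda>i. X t * (G ! k) i) \<in> span (take k G)"
        by blast
      then obtain c where c: "\<And>j. j < k \<Longrightarrow> c j \<in> sring"
          "(\<lambda>i. X t * (G ! k) i) = (\<lambda>i. \<Sum>j<k. c j * (G ! j) i)"
        using k by (auto simp: span_def)
      \<comment> \<open>The coefficients \<open>c j\<close> may be inhomogeneous. As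
        \<open>X t * (G ! k) i\<close> has degree 2, their degree 1 components already express it;
        this keeps the new generators linear.\<close>
      define \<sigma> where "\<sigma> j = (if j = k then X t else if j < k then - hcomp 1 (c j) else 0)" for j
      have hc: "(\<Sum>j<k. hcomp 1 (c j) * (G ! j) i) = X t * (G ! k) i" for i
      proof -
        have "X t * (G ! k) i \<in> scomp (1 + 1)"
          using k tW by (intro scomp_mult X_scomp G(2)) auto
        then have "X t * (G ! k) i = hcomp (1 + 1) (X t * (G ! k) i)"
          by (simp add: hcomp_id)
        also have "\<dots> = hcomp (1 + 1) (\<Sum>j<k. c j * (G ! j) i)"
          using c(2) by metis
        also have "\<dots> = (\<Sum>j<k. hcomp 1 (c j) * (G ! j) i)"
          unfolding hcomp_sum using k c(1) by (intro sum.cong refl hcomp_mult G(2)) auto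
        finally show ?thesis by simp
      qed
      have 1: "\<sigma> i \<in> scomp 1" for i
        using c(1) tW by (auto simp: \<sigma>_def intro: scomp_uminus hcomp_scomp X_scomp[simplified])
      moreover have "(\<Sum>j<Suc k. \<sigma> j * (G ! j) i) = 0" for i
        using hc[of i] by (simp add: \<sigma>_def sum_negf)
      ultimately show ?thesis
        by (intro exI[of _ \<sigma>]) (auto simp: syz_def \<sigma>_def[of k] intro: scomp_imp_sring, auto simp: \<sigma>_def)
    qed
    then obtain \<sigma> where \<sigma>: "\<And>t. t \<in> T \<Longrightarrow> \<sigma> t \<in> syz (Suc k) G \<and> \<sigma> t k = X t \<and> (\<forall>i. \<sigma> t i \<in> scomp 1)"
      by metis
    have ext: "span (H @ map \<sigma> ts) = {u \<in> syz (Suc k) G. u k \<in> mideal (set ts)} \<and> linear_quotients F (H @ map \<sigma> ts)"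
      using \<sigma> ts H by (intro extend_linear_quotients submod_syz) (auto simp: syz_Suc)
    \<comment> \<open>Solving the syzygy for its last term puts \<open>u k\<close> into the colon
      ideal, so the coordinate condition in \<open>ext\<close> holds on all of
      \<open>syz (Suc k) G\<close>.\<close>
    have "u k \<in> mideal T" if u: "u \<in> syz (Suc k) G" for u
    proof -
      have "u k * (G ! k) i = (\<Sum>j<k. (- u j) * (G ! j) i)" for i
      proof -
        have "(\<Sum>j<k. u j * (G ! j) i) + u k * (G ! k) i = 0"
          using u by (simp add: syz_def)
        then show ?thesis
          by (simp add: sum_negf eq_neg_iff_add_eq_0 add.commute)
      qed
      then have "(\<lambda>i. u k * (G ! k) i) = (\<lambda>i. \<Sum>j<length (take k G). (- u j) * (take k G ! j) i)"
        using k by simp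
      also have "\<dots> \<in> span (take k G)"
        using u by (intro spanI) (auto simp: syz_def intro: sring_uminus)
      finally show ?thesis
        using T(2) u by (auto simp: syz_def)
    qed
    with ext ts have "span (H @ map \<sigma> ts) = syz (Suc k) G"
      by auto
    with ext H(3) \<sigma> ts show ?case
      by (intro exI[of _ "H @ map \<sigma> ts"]) auto
  qed
  then show ?thesis by simp
qed

text \<open>Iterates \<open>linear_syzygies\<close>. The list \<open>G i\<close> will hold the
  images of the basis vectors under the \<open>i\<close>-th differential, beginning with the
  variables as vectors of rank 1.\<close>

lemma linear_resolution_sequence:
  assumes F: "koszul_filtration F"
  obtains G :: "nat \<Rightarrow> (nat \<Rightarrow> ('g \<Rightarrow>\<^sub>0 'k::field)) list"
  where "span (G 0) = {v. v 0 \<in> mideal W \<and> (\<forall>i\<ge>1. v i = 0)}"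
    and "\<And>i. span (G (Suc i)) = syz (length (G i)) (G i)"
    and "\<And>i g j. g \<in> set (G i) \<Longrightarrow> g j \<in> scomp 1"
proof -
  define P :: "(nat \<Rightarrow> ('g \<Rightarrow>\<^sub>0 'k)) list \<Rightarrow> bool"
    where "P G \<longleftrightarrow> linear_quotients F G \<and> (\<forall>g\<in>set G. \<forall>i. g i \<in> scomp 1)" for G
  define U :: "(nat \<Rightarrow> ('g \<Rightarrow>\<^sub>0 'k)) set" where "U = {v. (\<forall>i. v i \<in> sring) \<and> (\<forall>i\<ge>1. v i = 0)}"
  define \<sigma> :: "nat \<Rightarrow> nat \<Rightarrow> ('g \<Rightarrow>\<^sub>0 'k)" where "\<sigma> t i = (if i = 0 then X t else 0)" for t i
  from F obtain ws where ws: "set ws = W" "good_order F ws"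
    by (auto simp: koszul_filtration_def)
  have "submod U"
    by (auto simp: submod_def U_def intro: sring_add sring_mult)
  moreover have "span [] = {u \<in> U. u 0 = 0}"
  proof (intro equalityI subsetI)
    fix u assume u: "u \<in> {u \<in> U. u 0 = 0}"
    then have "u i = 0" for i
      by (cases i) (auto simp: U_def)
    then show "u \<in> span []"
      by (auto simp: span_Nil)
  qed (auto simp: span_Nil U_def)
  ultimately have "span ([] @ map \<sigma> ws) = {u \<in> U. u 0 \<in> mideal (set ws)} \<and> linear_quotients F ([] @ map \<sigma> ws)"
    using ws by (intro extend_linear_quotients) (auto simp: linear_quotients_def U_def \<sigma>_def intro: X_sring)
  moreover have "{u \<in> U. u 0 \<in> mideal (set ws)} = {v. v 0 \<in> mideal W \<and> (\<forall>i\<ge>1. v i = 0)}"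
  proof (intro equalityI subsetI)
    fix v assume v: "v \<in> {v. v 0 \<in> mideal W \<and> (\<forall>i\<ge>1::nat. v i = (0 :: 'g \<Rightarrow>\<^sub>0 'k))}"
    have "v i \<in> sring" for i
    proof (cases "i = 0")
      case True
      then show ?thesis
        using v mideal_subset_sring[of W] by auto
    next
      case False
      then have "1 \<le> i"
        by simp
      then have "v i = 0"
        using v by blast
      then show ?thesis
        by simp
    qed
    with v show "v \<in> {u \<in> U. u 0 \<in> mideal (set ws)}"
      by (simp add: U_def ws)
  qed (auto simp: U_def ws)
  moreover have "\<sigma> t i \<in> scomp 1" if "t \<in> W" for t i
    using that by (auto simp: \<sigma>_def intro: X_scomp[simplified])
  ultimately have init: "P (map \<sigma> ws)" "span (map \<sigma> ws) = {v. v 0 \<in> mideal W \<and> (\<forall>i\<ge>1. v i = 0)}"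
    using ws by (auto simp: P_def)
  have step: "\<exists>H. P H \<and> span H = syz (length G) G" if "P G" for G
    using linear_syzygies[OF F, of G] that by (auto simp: P_def)
  \<comment> \<open>The conjunct about \<open>n = 0\<close> pins the start, as dependent choice
    alone yields some first list with \<open>P\<close>.\<close>
  have "\<exists>G. \<forall>n. (P (G n) \<and> (n = 0 \<longrightarrow> G n = map \<sigma> ws)) \<and> span (G (Suc n)) = syz (length (G n)) (G n)"
  proof (rule dependent_nat_choice)
    show "\<exists>x. P x \<and> ((0::nat) = 0 \<longrightarrow> x = map \<sigma> ws)"
      using init(1) by blast
  next
    fix G and n :: nat assume "P G \<and> (n = 0 \<longrightarrow> G = map \<sigma> ws)"
    then show "\<exists>H. (P H \<and> (Suc n = 0 \<longrightarrow> H = map \<sigma> ws)) \<and> span H = syz (length G) G"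
      using step[of G] by auto
  qed
  then obtain G where G: "\<And>n. P (G n)" "G 0 = map \<sigma> ws"
      "\<And>n. span (G (Suc n)) = syz (length (G n)) (G n)"
    by blast
  show thesis
  proof (rule that[of G])
    show "span (G 0) = {v. v 0 \<in> mideal W \<and> (\<forall>i\<ge>1. v i = 0)}"
      using init(2) G(2) by simp
    show "span (G (Suc i)) = syz (length (G i)) (G i)" for i
      by (rule G(3))
    show "g j \<in> scomp 1" if "g \<in> set (G i)" for i g j
      using G(1)[of i] that by (simp add: P_def)
  qed
qed

end


section \<open>From a Koszul filtration to a linear resolution\<close>

text \<open>\<open>\<psi>\<close> carries the record-based ring \<open>A\<close> to the type-class
  arithmetic on \<open>sring\<close>. By \<open>gr_eq\<close> an element of negative degree has an
  image with empty support, so it is zero.\<close>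

locale semigroup_algebra = graded_semigroup S W at deg + cring A
  for S :: "'g::cancel_comm_monoid_add set" and W at deg and A :: "('a, 'm) ring_scheme" (structure) +
  fixes gr :: "int \<Rightarrow> 'a set" and \<psi> :: "'a \<Rightarrow> ('g \<Rightarrow>\<^sub>0 'k::field)"
  assumes psi_add: "x \<in> carrier A \<Longrightarrow> y \<in> carrier A \<Longrightarrow> \<psi> (x \<oplus> y) = \<psi> x + \<psi> y"
    and psi_mult: "x \<in> carrier A \<Longrightarrow> y \<in> carrier A \<Longrightarrow> \<psi> (x \<otimes> y) = \<psi> x * \<psi> y"
    and psi_one: "\<psi> \<one> = 1"
    and psi_bij: "bij_betw \<psi> (carrier A) sring"
    and gr_eq: "gr d = {x \<in> carrier A. \<forall>s\<in>Poly_Mapping.keys (\<psi> x). int (deg s) = d}"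
begin

definition \<phi> :: "('g \<Rightarrow>\<^sub>0 'k) \<Rightarrow> 'a"
  where "\<phi> = inv_into (carrier A) \<psi>"

lemma psi_sring [simp]: "x \<in> carrier A \<Longrightarrow> \<psi> x \<in> sring"
  using psi_bij by (auto simp: bij_betw_def)

lemma phi_carrier [simp]: "q \<in> sring \<Longrightarrow> \<phi> q \<in> carrier A"
  unfolding \<phi>_def using psi_bij by (metis bij_betw_def inv_into_into)

lemma psi_phi [simp]: "q \<in> sring \<Longrightarrow> \<psi> (\<phi> q) = q"
  unfolding \<phi>_def using psi_bij by (metis bij_betw_def f_inv_into_f)

lemma psi_eq_iff: "x \<in> carrier A \<Longrightarrow> y \<in> carrier A \<Longrightarrow> \<psi> x = \<psi> y \<longleftrightarrow> x = y"
  using psi_bij by (auto simp: bij_betw_def inj_on_def)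

lemma phi_psi [simp]: "x \<in> carrier A \<Longrightarrow> \<phi> (\<psi> x) = x"
  by (rule psi_eq_iff[THEN iffD1]) auto

lemma psi_zero [simp]: "\<psi> \<zero> = 0"
  using psi_add[of \<zero> \<zero>] by simp

lemma psi_uminus: "x \<in> carrier A \<Longrightarrow> \<psi> (\<ominus> x) = - \<psi> x"
  using psi_add[of x "\<ominus> x"] by (simp add: r_neg eq_neg_iff_add_eq_0 add.commute)

lemma psi_eq_0_iff: "x \<in> carrier A \<Longrightarrow> \<psi> x = 0 \<longleftrightarrow> x = \<zero>"
  using psi_eq_iff[of x \<zero>] by simp

lemma phi_0 [simp]: "\<phi> 0 = \<zero>"
  using phi_psi[of \<zero>] by simp

lemma phi_add: "p \<in> sring \<Longrightarrow> q \<in> sring \<Longrightarrow> \<phi> (p + q) = \<phi> p \<oplus> \<phi> q"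
  by (intro psi_eq_iff[THEN iffD1]) (auto simp: psi_add sring_add)

lemma phi_mult: "p \<in> sring \<Longrightarrow> q \<in> sring \<Longrightarrow> \<phi> (p * q) = \<phi> p \<otimes> \<phi> q"
  by (intro psi_eq_iff[THEN iffD1]) (auto simp: psi_mult sring_mult)

lemma gr_iff: "x \<in> gr (int n) \<longleftrightarrow> x \<in> carrier A \<and> \<psi> x \<in> scomp n"
  using psi_sring[of x] unfolding gr_eq scomp_def sring_def by auto

lemma gr_carrier: "x \<in> gr d \<Longrightarrow> x \<in> carrier A"
  by (simp add: gr_eq)

text \<open>For the inclusion from right to left, an element is split into its terms: each monomial
  is divisible by a variable, so each term is homogeneous of positive degree and hence among the
  generators.\<close>

lemma irrelevant_ideal_eq: "irrelevant_ideal A gr = {x \<in> carrier A. \<psi> x \<in> mideal W}" (is "_ = ?M")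
proof
  have "ideal ?M A"
  proof (rule idealI)
    show "subgroup ?M (add_monoid A)"
      by (rule add.subgroupI)
        (auto simp: psi_add psi_uminus mideal_def intro: mideal_add[unfolded mideal_def, simplified, THEN subsetD] exI[of _ \<zero>])
  next
    fix a x assume "a \<in> ?M" "x \<in> carrier A"
    then show "x \<otimes> a \<in> ?M" "a \<otimes> x \<in> ?M"
      using mideal_mult[of "\<psi> x" "\<psi> a"] by (auto simp: psi_mult mult.commute)
  qed (rule ring_axioms)
  moreover have "(\<Union>d\<in>{0<..}. gr d) \<subseteq> ?M"
  proof
    fix x assume "x \<in> (\<Union>d\<in>{0<..}. gr d)"
    then obtain d where d: "d > 0" "x \<in> gr d" by auto
    have "s \<in> divisible W" if "s \<in> Poly_Mapping.keys (\<psi> x)" for s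
    proof -
      have "s \<in> S" "deg s \<noteq> 0"
        using that d psi_sring[of x] by (auto simp: gr_eq sring_def)
      then obtain w s' where "w \<in> W" "s' \<in> S" "s = at w + s'"
        using decompose[of s] deg_zero by (cases "s = 0") auto
      then show ?thesis
        by (auto simp: divisible_def)
    qed
    then show "x \<in> ?M"
      using d by (auto simp: mideal_def gr_carrier)
  qed
  ultimately show "irrelevant_ideal A gr \<subseteq> ?M"
    unfolding irrelevant_ideal_def genideal_def by blast
next
  show "?M \<subseteq> irrelevant_ideal A gr"
    unfolding irrelevant_ideal_def genideal_def
  proof (intro subsetI InterI)
    fix x I assume x: "x \<in> ?M" and "I \<in> {I. ideal I A \<and> (\<Union>d\<in>{0<..}. gr d) \<subseteq> I}"
    then interpret I: ideal I A by auto
    have I: "\<And>d. d > 0 \<Longrightarrow> gr d \<subseteq> I"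
      using \<open>I \<in> _\<close> by auto
    define f where "f s = Poly_Mapping.single s (Poly_Mapping.lookup (\<psi> x) s)" for s
    have "\<phi> (sum f K) \<in> I \<and> sum f K \<in> sring" if "finite K" "K \<subseteq> Poly_Mapping.keys (\<psi> x)" for K
      using that
    proof (induction K rule: finite_induct)
      case (insert s K)
      then have "s \<in> divisible W"
        using x by (auto simp: mideal_def)
      then have s: "s \<in> S" "deg s > 0"
        by (auto simp: divisible_def add_in at_in deg_add deg_at)
      have fs: "f s \<in> sring"
        using s by (auto simp: f_def sring_def)
      have "\<phi> (f s) \<in> gr (int (deg s))"
        using fs s by (auto simp: gr_iff scomp_def) (auto simp: f_def split: if_splits)
      with I[of "int (deg s)"] s have "\<phi> (f s) \<in> I" by auto
      with insert fs show ?case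
        by (auto simp: phi_add sring_add)
    qed (auto simp: I.zero_closed)
    from this[of "Poly_Mapping.keys (\<psi> x)"] show "x \<in> I"
      using poly_mapping_eq_sum_single[of "\<psi> x"] x unfolding f_def by simp
  qed
qed

lemma one_notin_irrelevant: "\<one> \<notin> irrelevant_ideal A gr"
proof
  assume "\<one> \<in> irrelevant_ideal A gr"
  then have "0 \<in> divisible W"
    by (auto simp: irrelevant_ideal_eq psi_one mideal_def)
  then obtain t s where "0 = at t + s" "t \<in> W" "s \<in> S"
    by (auto simp: divisible_def)
  then have "deg (at t) + deg s = 0"
    by (metis at_in deg_add deg_zero)
  then show False
    using deg_at \<open>t \<in> W\<close> by simp
qed

lemma ideal_irrelevant: "ideal (irrelevant_ideal A gr) A"
  unfolding irrelevant_ideal_def by (rule genideal_ideal) (auto simp: gr_eq)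

theorem koszul_filtration_imp_koszul:
  assumes F: "koszul_filtration F"
  shows "koszul_algebra A gr"
proof -
  obtain G :: "nat \<Rightarrow> (nat \<Rightarrow> ('g \<Rightarrow>\<^sub>0 'k)) list"
    where G0: "span (G 0) = {v. v 0 \<in> mideal W \<and> (\<forall>i\<ge>1. v i = 0)}"
      and GS: "\<And>i. span (G (Suc i)) = syz (length (G i)) (G i)"
      and Gs: "\<And>i g j. g \<in> set (G i) \<Longrightarrow> g j \<in> scomp 1"
    by (rule linear_resolution_sequence[OF F]) (rule that)
  let ?I = "irrelevant_ideal A gr"
  interpret I: ideal ?I A by (rule ideal_irrelevant)
  \<comment> \<open>Index shift: \<open>G i\<close> has \<open>b (Suc i)\<close> members, each a
    vector with \<open>b i\<close> relevant coordinates.\<close>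
  define b where "b i = (case i of 0 \<Rightarrow> 1 | Suc n \<Rightarrow> length (G n))" for i
  have b0: "b 0 = 1" and bS: "\<And>i. b (Suc i) = length (G i)"
    by (auto simp: b_def)
  let ?F = "\<lambda>i. free_module A (b i)"
  have carF: "carrier (?F i) = {..<b i} \<rightarrow>\<^sub>E carrier A" for i
    by (simp add: free_module_def)
  define mul where "mul i v j = (\<Sum>k<b (Suc i). \<psi> (v k) * (G i ! k) j)" for i v j
  define D where "D i v = (\<lambda>j\<in>{..<b i}. \<phi> (mul i v j))" for i v
  define e where "e v = ?I +> v 0" for v :: "nat \<Rightarrow> 'a"
  \<comment> \<open>Module elements are \<open>undefined\<close> outside \<open>{..<b i}\<close>,
    whereas vectors in a \<open>span\<close> are 0 there; \<open>lift\<close> passes from the former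
    to the latter.\<close>
  define lift where "lift i v j = (if j < b i then \<psi> (v j) else 0)" for i and v :: "nat \<Rightarrow> 'a" and j
  have G_scomp: "(G i ! k) j \<in> scomp 1" if "k < b (Suc i)" for i k j
    using that Gs[of "G i ! k" i] by (simp add: bS)
  have G_sring: "(G i ! k) j \<in> sring" if "k < b (Suc i)" for i k j
    using scomp_imp_sring G_scomp that by blast
  have vk: "v k \<in> carrier A" if "v \<in> carrier (?F i)" "k < b i" for v i k
    using that by (auto simp: carF)
  have mul_span: "mul i v \<in> span (G i)" if "v \<in> carrier (?F (Suc i))" for i v
    unfolding mul_def bS by (rule spanI) (use vk[OF that] in \<open>auto simp: bS\<close>)
  have span0: "u j = 0" if "u \<in> span (G i)" "j \<ge> b i" for u i j
    using that G0 GS by (cases i) (auto simp: b0 bS syz_def)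
  have mul_sring: "mul i v j \<in> sring" if "v \<in> carrier (?F (Suc i))" for i v j
    unfolding mul_def using that by (intro sring_sum sring_mult psi_sring G_sring vk) auto
  have D_carrier: "D i v \<in> carrier (?F i)" if "v \<in> carrier (?F (Suc i))" for i v
    using mul_sring[OF that] by (auto simp: D_def carF)
  have lift_D: "lift i (D i v) = mul i v" if "v \<in> carrier (?F (Suc i))" for i v
    using mul_sring[OF that] span0[OF mul_span[OF that]] by (auto simp: lift_def D_def)
  have image_D: "D i ` carrier (?F (Suc i)) = {u \<in> carrier (?F i). lift i u \<in> span (G i)}" for i
  proof (intro equalityI subsetI)
    fix u assume "u \<in> D i ` carrier (?F (Suc i))"
    then show "u \<in> {u \<in> carrier (?F i). lift i u \<in> span (G i)}"
      using D_carrier lift_D mul_span by auto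
  next
    fix u assume "u \<in> {u \<in> carrier (?F i). lift i u \<in> span (G i)}"
    then obtain c where u: "u \<in> carrier (?F i)" and c: "\<And>k. k < b (Suc i) \<Longrightarrow> c k \<in> sring"
        "lift i u = (\<lambda>j. \<Sum>k<b (Suc i). c k * (G i ! k) j)"
      by (auto simp: span_def bS)
    define v where "v = (\<lambda>k\<in>{..<b (Suc i)}. \<phi> (c k))"
    have v: "v \<in> carrier (?F (Suc i))"
      using c(1) by (auto simp: v_def carF)
    have "mul i v = lift i u"
      unfolding c(2) mul_def by (intro ext sum.cong) (auto simp: v_def c(1))
    then have "D i v = u"
      using u vk[OF u] by (intro extensionalityI[of _ "{..<b i}"]) (auto simp: D_def lift_def carF PiE_def)
    then show "u \<in> D i ` carrier (?F (Suc i))"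
      using v by blast
  qed
  have ker_D: "a_kernel (?F (Suc i)) (?F i) (D i) = {u \<in> carrier (?F (Suc i)). lift (Suc i) u \<in> syz (b (Suc i)) (G i)}" for i
  proof -
    have "D i u = zero (?F i) \<longleftrightarrow> lift (Suc i) u \<in> syz (b (Suc i)) (G i)" if u: "u \<in> carrier (?F (Suc i))" for u
    proof -
      have "D i u = zero (?F i) \<longleftrightarrow> (\<forall>j<b i. \<phi> (mul i u j) = \<zero>)"
        by (auto simp: D_def free_module_def restrict_def fun_eq_iff)
      also have "\<dots> \<longleftrightarrow> (\<forall>j<b i. mul i u j = 0)"
        using mul_sring[OF u] by (metis phi_0 psi_phi psi_zero)
      also have "\<dots> \<longleftrightarrow> (\<forall>j. mul i u j = 0)"
        using span0[OF mul_span[OF u]] by (metis not_le)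
      also have "\<dots> \<longleftrightarrow> lift (Suc i) u \<in> syz (b (Suc i)) (G i)"
        using vk[OF u] by (auto simp: syz_def mul_def lift_def)
      finally show ?thesis .
    qed
    then show ?thesis
      by (auto simp: a_kernel_def')
  qed
  have e0: "e v = zero (A Quot ?I) \<longleftrightarrow> v 0 \<in> ?I" if "v \<in> carrier (?F 0)" for v
  proof -
    have v: "v 0 \<in> carrier A"
      using vk[OF that] by (simp add: b0)
    then have "?I +> v 0 = ?I \<longleftrightarrow> v 0 \<in> ?I"
      by (metis I.a_rcos_const I.a_rcos_self)
    then show ?thesis
      by (simp add: e_def FactRing_def)
  qed
  have "linear_free_resolution A gr (quot_module A ?I) (quot_grading A gr ?I) b D e"
    unfolding linear_free_resolution_def
  proof (intro conjI allI)
    show "e \<in> graded_module_hom A (?F 0) (shifted_free_grading gr 0 (b 0)) (quot_module A ?I) (quot_grading A gr ?I)"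
      using vk[of _ 0 0] I.a_rcos_sum I.rcoset_mult_add
      by (auto simp: graded_module_hom_def e_def quot_module_def quot_grading_def
          shifted_free_grading_def b0 free_module_def FactRing_def a_rcosetsI I.a_subset)
  next
    fix i
    show "D i \<in> graded_module_hom A (?F (Suc i)) (shifted_free_grading gr (Suc i) (b (Suc i)))
        (?F i) (shifted_free_grading gr i (b i))"
      unfolding graded_module_hom_def
    proof (intro CollectI conjI ballI allI Pi_I)
      show "D i v \<in> carrier (?F i)" if "v \<in> carrier (?F (Suc i))" for v
        by (rule D_carrier) fact
    next
      fix v w assume vw: "v \<in> carrier (?F (Suc i))" "w \<in> carrier (?F (Suc i))"
      have "mul i (v \<oplus>\<^bsub>?F (Suc i)\<^esub> w) j = mul i v j + mul i w j" for j
        using vk[OF vw(1)] vk[OF vw(2)]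
        by (simp add: mul_def free_module_def psi_add distrib_right flip: sum.distrib)
      then show "D i (v \<oplus>\<^bsub>?F (Suc i)\<^esub> w) = D i v \<oplus>\<^bsub>?F i\<^esub> D i w"
        using mul_sring[OF vw(1)] mul_sring[OF vw(2)]
        by (auto simp: D_def free_module_def phi_add)
    next
      fix a v assume av: "a \<in> carrier A" "v \<in> carrier (?F (Suc i))"
      have "mul i (a \<odot>\<^bsub>?F (Suc i)\<^esub> v) j = \<psi> a * mul i v j" for j
        using vk[OF av(2)] av(1)
        by (simp add: mul_def free_module_def psi_mult sum_distrib_left mult.assoc)
      then show "D i (a \<odot>\<^bsub>?F (Suc i)\<^esub> v) = a \<odot>\<^bsub>?F i\<^esub> D i v"
        using mul_sring[OF av(2)] av(1)
        by (auto simp: D_def free_module_def phi_mult)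
    next
      fix d
      show "D i ` shifted_free_grading gr (Suc i) (b (Suc i)) d \<subseteq> shifted_free_grading gr i (b i) d"
      proof (rule image_subsetI)
        fix v assume v: "v \<in> shifted_free_grading gr (Suc i) (b (Suc i)) d"
        have vd: "v k \<in> gr (d - int (Suc i))" if "k < b (Suc i)" for k
          using v that by (auto simp: shifted_free_grading_def)
        have vF: "v \<in> carrier (?F (Suc i))"
          using v gr_carrier by (auto simp: shifted_free_grading_def carF PiE_iff)
        have "int (deg s) = d - int i" if s: "s \<in> Poly_Mapping.keys (mul i v j)" for s j
        proof -
          obtain k where k: "k < b (Suc i)" "s \<in> Poly_Mapping.keys (\<psi> (v k) * (G i ! k) j)"
            using s Poly_Mapping.keys_sum[of "\<lambda>k. \<psi> (v k) * (G i ! k) j" "{..<b (Suc i)}"]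
            unfolding mul_def by auto
          then obtain x y where xy: "s = x + y" "x \<in> Poly_Mapping.keys (\<psi> (v k))"
              "y \<in> Poly_Mapping.keys ((G i ! k) j)"
            using Poly_Mapping.keys_mult[of "\<psi> (v k)" "(G i ! k) j"] by blast
          moreover have "x \<in> S" "int (deg x) = d - int (Suc i)"
            using xy(2) vd[OF k(1)] psi_sring[OF vk[OF vF k(1)]] by (auto simp: gr_eq sring_def)
          moreover have "y \<in> S" "deg y = 1"
            using xy(3) G_scomp[OF k(1), of j] by (auto simp: scomp_def)
          ultimately show ?thesis
            by (simp add: deg_add)
        qed
        then show "D i v \<in> shifted_free_grading gr i (b i) d"
          using mul_sring[OF vF] by (auto simp: shifted_free_grading_def D_def gr_eq)
      qed
    qed
  next
    show "e ` carrier (?F 0) = carrier (quot_module A ?I)"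
    proof (intro equalityI subsetI)
      fix X assume "X \<in> e ` carrier (?F 0)"
      then show "X \<in> carrier (quot_module A ?I)"
        using vk[of _ 0 0] by (auto simp: e_def quot_module_def FactRing_def b0 a_rcosetsI I.a_subset)
    next
      fix X assume "X \<in> carrier (quot_module A ?I)"
      then obtain x where x: "x \<in> carrier A" "X = ?I +> x"
        by (auto simp: quot_module_def FactRing_def A_RCOSETS_def')
      then show "X \<in> e ` carrier (?F 0)"
        by (intro image_eqI[of _ _ "\<lambda>j\<in>{..<1}. x"]) (auto simp: e_def free_module_def b0)
    qed
  next
    have "a_kernel (?F 0) (quot_module A ?I) e = {v \<in> carrier (?F 0). v 0 \<in> ?I}"
      using e0 by (auto simp: a_kernel_def' quot_module_def)
    also have "\<dots> = {u \<in> carrier (?F 0). lift 0 u \<in> span (G 0)}"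
    proof -
      have "v 0 \<in> ?I \<longleftrightarrow> lift 0 v \<in> span (G 0)" if "v \<in> carrier (?F 0)" for v
      proof -
        have "v 0 \<in> carrier A"
          using vk[OF that] by (simp add: b0)
        moreover have "lift 0 v i = 0" if "i \<ge> 1" for i
          using that by (simp add: lift_def b0)
        moreover have "lift 0 v 0 = \<psi> (v 0)"
          by (simp add: lift_def b0)
        ultimately show ?thesis
          unfolding G0 irrelevant_ideal_eq by simp
      qed
      then show ?thesis by blast
    qed
    finally show "D 0 ` carrier (free_module A (b 1)) = a_kernel (?F 0) (quot_module A ?I) e"
      using image_D[of 0] by simp
  next
    fix i
    \<comment> \<open>Once image and kernel are expressed through \<open>span\<close> and
      \<open>syz\<close>, exactness is the equation \<open>GS\<close>.\<close>
    show "D (Suc i) ` carrier (?F (Suc (Suc i))) = a_kernel (?F (Suc i)) (?F i) (D i)"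
      by (simp only: image_D ker_D GS flip: bS)
  qed
  then show ?thesis
    unfolding koszul_algebra_def has_linear_free_resolution_def by blast
qed

end


section \<open>Connectedness of factorizations\<close>

context graded_semigroup
begin

lemma scomp_1_mideal: "scomp 1 \<subseteq> mideal W"
proof
  fix p :: "'g \<Rightarrow>\<^sub>0 'k::field" assume p: "p \<in> scomp 1"
  have "s \<in> divisible W" if "s \<in> Poly_Mapping.keys p" for s
  proof -
    have "s \<in> S" "deg s = 1"
      using p that by (auto simp: scomp_def)
    then obtain w where "w \<in> W" "s = at w + 0"
      using deg_eq_1 by fastforce
    then show ?thesis
      using zero_in unfolding divisible_def by blast
  qed
  then show "p \<in> mideal W"
    by (auto simp: mideal_def)
qed

lemma scomp_0_eq: "p \<in> scomp 0 \<Longrightarrow> p = Poly_Mapping.single 0 (Poly_Mapping.lookup p 0)"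
  using deg_eq_0 by (intro poly_mapping_eqI) (fastforce simp: lookup_single when_def scomp_def in_keys_iff)

lemma zero_notin_divisible: "T \<subseteq> W \<Longrightarrow> 0 \<notin> divisible T"
  unfolding divisible_def using deg_add at_in deg_at deg_zero by fastforce

lemma scomp_0_mideal: "p \<in> scomp 0 \<Longrightarrow> p \<in> mideal W \<Longrightarrow> p = 0"
  using zero_notin_divisible[of W] scomp_0_eq[of p]
  by (metis empty_subsetI insert_subset keys_single mem_Collect_eq mideal_def single_zero order.refl)

lemma scomp_1_eq_sum:
  assumes "p \<in> scomp 1"
  shows "p = (\<Sum>t\<in>W. Poly_Mapping.single 0 (Poly_Mapping.lookup p (at t)) * X t)"
proof (rule poly_mapping_eqI)
  fix s
  have eq: "Poly_Mapping.lookup (\<Sum>t\<in>W. Poly_Mapping.single 0 (Poly_Mapping.lookup p (at t)) * X t) s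
      = (\<Sum>t\<in>W. if at t = s then Poly_Mapping.lookup p s else 0)"
    by (auto simp: lookup_sum X_def mult_single lookup_single when_def intro!: sum.cong)
  show "Poly_Mapping.lookup p s
      = Poly_Mapping.lookup (\<Sum>t\<in>W. Poly_Mapping.single 0 (Poly_Mapping.lookup p (at t)) * X t) s"
  proof (cases "\<exists>w\<in>W. s = at w")
    case True
    then obtain w where w: "w \<in> W" "s = at w" by auto
    then have "(\<Sum>t\<in>W. if at t = s then Poly_Mapping.lookup p s else 0)
        = (\<Sum>t\<in>W. if t = w then Poly_Mapping.lookup p s else 0)"
      using inj_at by (intro sum.cong) (auto dest: inj_onD)
    then show ?thesis
      unfolding eq using w finite_W by simp
  next
    case False
    then have "s \<notin> Poly_Mapping.keys p"
      using assms deg_eq_1 by (auto simp: scomp_def)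
    moreover have "(\<Sum>t\<in>W. if at t = s then Poly_Mapping.lookup p s else 0) = 0"
      using False by (intro sum.neutral) auto
    ultimately show ?thesis
      by (simp add: eq in_keys_iff)
  qed
qed

text \<open>A linear syzygy of the variables, multiplied into degree \<open>deg s\<close> by elements of positive
  degree, cannot distinguish the classes of factorizations of \<open>s\<close> that share no variable.\<close>

lemma lookup_partial_syzygy:
  fixes a :: "'g \<Rightarrow>\<^sub>0 'k::field"
  assumes s: "deg s \<ge> 3" and P: "P \<subseteq> W"
    and closed: "\<And>i j t. i \<in> P \<Longrightarrow> j \<in> W \<Longrightarrow> t \<in> S \<Longrightarrow> s = at i + at j + t \<Longrightarrow> j \<in> P"
    and g: "\<And>t. t \<in> W \<Longrightarrow> g t \<in> scomp 1"
    and syz: "(\<Sum>t\<in>W. g t * X t) = 0"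
    and a: "a \<in> sring"
  shows "Poly_Mapping.lookup (a * (\<Sum>t\<in>P. g t * X t)) s = 0"
proof -
  define Z where "Z Q = (\<Sum>t\<in>Q. g t * X t)" for Q
  have Z_keys: "\<exists>t\<in>Q. \<exists>x\<in>S. deg x = 1 \<and> s = s' + x + at t"
    if "Poly_Mapping.lookup (Poly_Mapping.single s' c * Z Q) s \<noteq> 0" "Q \<subseteq> W" for s' c Q
  proof -
    have "s \<in> Poly_Mapping.keys (Poly_Mapping.single s' c * Z Q)"
      using that by (simp add: in_keys_iff)
    then obtain z where z: "s = s' + z" "z \<in> Poly_Mapping.keys (Z Q)"
      using Poly_Mapping.keys_mult[of "Poly_Mapping.single s' c" "Z Q"] by (auto split: if_splits)
    then obtain t where t: "t \<in> Q" "z \<in> Poly_Mapping.keys (g t * X t)"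
      using Poly_Mapping.keys_sum[of "\<lambda>t. g t * X t" Q] by (auto simp: Z_def)
    then obtain x where "x \<in> Poly_Mapping.keys (g t)" "z = at t + x"
      by (auto simp: keys_mult_X)
    moreover from this t that(2) g[of t] have "x \<in> S" "deg x = 1"
      by (auto simp: scomp_def)
    ultimately show ?thesis
      using t z by (intro bexI[of _ t] bexI[of _ x]) (auto simp: add_ac)
  qed
  \<comment> \<open>The full sum vanishes, so the part over \<open>P\<close> may also be computed
    over the complement. A nonzero coefficient at \<open>s\<close> then produces a factorization on
    either side, both containing \<open>s'\<close>.\<close>
  have Z_split: "Z P = - Z (W - P)"
    using syz sum.subset_diff[OF P finite_W, of "\<lambda>t. g t * X t"]
    by (simp add: Z_def eq_neg_iff_add_eq_0 add.commute)
  have single: "Poly_Mapping.lookup (Poly_Mapping.single s' c * Z P) s = 0" if s': "s' \<in> S" for s' c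
  proof (rule ccontr)
    assume nz: "Poly_Mapping.lookup (Poly_Mapping.single s' c * Z P) s \<noteq> 0"
    then obtain t x where tx: "t \<in> P" "x \<in> S" "deg x = 1" "s = s' + x + at t"
      using Z_keys[OF _ P] by blast
    \<comment> \<open>The bound \<open>deg s \<ge> 3\<close> enters here: it leaves
      \<open>s'\<close> positive degree, hence a variable \<open>k\<close> shared by both
      factorizations, which transports membership in \<open>P\<close> across.\<close>
    then have "deg s = deg s' + 2"
      using s' P deg_add add_in at_in deg_at by (metis add.assoc nat_1_add_1 subsetD)
    with s have "s' \<noteq> 0"
      using deg_zero by auto
    then obtain k s'' where k: "k \<in> W" "s'' \<in> S" "s' = at k + s''"
      using decompose s' by blast
    have "s = at t + at k + (s'' + x)"
      using tx k by (simp add: add_ac)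
    then have kP: "k \<in> P"
      using closed[of t k "s'' + x"] tx k add_in by auto
    from nz have "Poly_Mapping.lookup (Poly_Mapping.single s' c * Z (W - P)) s \<noteq> 0"
      by (simp add: Z_split)
    then obtain t' x' where t': "t' \<in> W - P" "x' \<in> S" "s = s' + x' + at t'"
      using Z_keys[of s' c "W - P"] by blast
    then have "s = at k + at t' + (s'' + x')"
      using k by (simp add: add_ac)
    with closed[of k t' "s'' + x'"] kP t' k add_in show False
      by auto
  qed
  have "a * Z P = (\<Sum>s'\<in>Poly_Mapping.keys a. Poly_Mapping.single s' (Poly_Mapping.lookup a s') * Z P)"
    by (subst poly_mapping_eq_sum_single[of a]) (simp add: sum_distrib_right)
  then have "Poly_Mapping.lookup (a * Z P) s = 0"
    using single a by (auto simp: lookup_sum sring_def intro!: sum.neutral)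
  then show ?thesis
    by (simp add: Z_def)
qed

end

context semigroup_algebra
begin

section \<open>The matrices of a linear resolution\<close>

definition unit_vec :: "nat \<Rightarrow> nat \<Rightarrow> nat \<Rightarrow> 'a"
  where "unit_vec n k = (\<lambda>j\<in>{..<n}. if j = k then \<one> else \<zero>)"

lemma unit_vec_carrier: "unit_vec n k \<in> carrier (free_module A n)"
  by (auto simp: unit_vec_def free_module_def)

text \<open>The shift by \<open>i\<close> puts the standard basis in degree \<open>i\<close>. A
  degree 0 map from a module shifted by \<open>Suc i\<close> to one shifted by \<open>i\<close>
  therefore has entries of degree 1.\<close>

lemma unit_vec_graded: "unit_vec n k \<in> shifted_free_grading gr i n (int i)"
  using gr_iff[of \<one> 0] gr_iff[of \<zero> 0] scomp_def[of 0] zero_in deg_zero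
  by (auto simp: unit_vec_def shifted_free_grading_def psi_one)

context
  fixes h :: "(nat \<Rightarrow> 'a) \<Rightarrow> (nat \<Rightarrow> 'a)" and n r i :: nat
  assumes h: "h \<in> graded_module_hom A (free_module A n) (shifted_free_grading gr (Suc i) n)
    (free_module A r) (shifted_free_grading gr i r)"
begin

lemma hom_carrier: "v \<in> carrier (free_module A n) \<Longrightarrow> j < r \<Longrightarrow> h v j \<in> carrier A"
  using h by (auto simp: graded_module_hom_def free_module_def)

lemma hom_unit_scomp: "j < r \<Longrightarrow> \<psi> (h (unit_vec n k) j) \<in> scomp 1"
proof -
  assume j: "j < r"
  have "h ` shifted_free_grading gr (Suc i) n (int (Suc i)) \<subseteq> shifted_free_grading gr i r (int (Suc i))"
    using h unfolding graded_module_hom_def by blast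
  then have "h (unit_vec n k) \<in> shifted_free_grading gr i r (int (Suc i))"
    using unit_vec_graded by blast
  then have "h (unit_vec n k) j \<in> gr (int 1)"
    using j by (auto simp: shifted_free_grading_def)
  then show ?thesis
    by (simp only: gr_iff)
qed

lemma hom_expand:
  assumes v: "v \<in> carrier (free_module A n)" and j: "j < r"
  shows "\<psi> (h v j) = (\<Sum>k<n. \<psi> (v k) * \<psi> (h (unit_vec n k) j))"
proof -
  let ?F = "free_module A n"
  define tr where "tr l = (\<lambda>k\<in>{..<n}. if k < l then v k else \<zero>)" for l
  have vk: "v k \<in> carrier A" if "k < n" for k
    using v that by (auto simp: free_module_def)
  have tr_carrier: "tr l \<in> carrier ?F" for l
    using vk by (auto simp: tr_def free_module_def)
  have smult: "\<psi> (h (a \<odot>\<^bsub>?F\<^esub> x) j) = \<psi> a * \<psi> (h x j)" if "a \<in> carrier A" "x \<in> carrier ?F" for a x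
  proof -
    have "h (a \<odot>\<^bsub>?F\<^esub> x) = a \<odot>\<^bsub>free_module A r\<^esub> h x"
      using h that by (auto simp: graded_module_hom_def)
    then show ?thesis
      using j that hom_carrier by (simp add: free_module_def[of _ r] psi_mult)
  qed
  have add: "\<psi> (h (x \<oplus>\<^bsub>?F\<^esub> y) j) = \<psi> (h x j) + \<psi> (h y j)" if "x \<in> carrier ?F" "y \<in> carrier ?F" for x y
  proof -
    have "h (x \<oplus>\<^bsub>?F\<^esub> y) = h x \<oplus>\<^bsub>free_module A r\<^esub> h y"
      using h that by (auto simp: graded_module_hom_def)
    then show ?thesis
      using j that hom_carrier by (simp add: free_module_def[of _ r] psi_add)
  qed
  have "\<psi> (h (tr l) j) = (\<Sum>k<l. \<psi> (v k) * \<psi> (h (unit_vec n k) j))" if "l \<le> n" for l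
    using that
  proof (induction l)
    case 0
    \<comment> \<open>Homomorphisms are specified by sums and multiples, so the zero vector is
      written as a zero multiple to see that its image vanishes.\<close>
    have "tr 0 = \<zero> \<odot>\<^bsub>?F\<^esub> tr 0"
      by (auto simp: tr_def free_module_def)
    then have "\<psi> (h (tr 0) j) = \<psi> \<zero> * \<psi> (h (tr 0) j)"
      using smult[OF zero_closed tr_carrier] by metis
    then show ?case by simp
  next
    case (Suc l)
    then have l: "v l \<in> carrier A"
      using vk by simp
    have "tr (Suc l) = tr l \<oplus>\<^bsub>?F\<^esub> (v l \<odot>\<^bsub>?F\<^esub> unit_vec n l)"
      using vk l by (auto simp: tr_def free_module_def unit_vec_def fun_eq_iff restrict_def less_Suc_eq)
    moreover have "v l \<odot>\<^bsub>?F\<^esub> unit_vec n l \<in> carrier ?F"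
      using l by (auto simp: free_module_def unit_vec_def)
    ultimately have "\<psi> (h (tr (Suc l)) j) = \<psi> (h (tr l) j) + \<psi> (v l) * \<psi> (h (unit_vec n l) j)"
      using add[OF tr_carrier, of "v l \<odot>\<^bsub>?F\<^esub> unit_vec n l"] smult[OF l unit_vec_carrier] by simp
    with Suc show ?case by simp
  qed
  moreover have "tr n = v"
    using v by (intro extensionalityI[of _ "{..<n}"]) (auto simp: tr_def free_module_def PiE_def)
  ultimately show ?thesis
    by fastforce
qed

end

text \<open>The entries of \<open>D 0\<close> have degree 1, so every element of the kernel of
  \<open>e\<close> has its coordinates in the irrelevant ideal; thus no basis vector is killed by
  \<open>e\<close>. On the basis, \<open>e\<close> takes constant values modulo that ideal, and two
  such values would be proportional over the field.\<close>

lemma augmentation_rank: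
  assumes res: "linear_free_resolution A gr (quot_module A (irrelevant_ideal A gr))
      (quot_grading A gr (irrelevant_ideal A gr)) b D e"
  shows "b 0 = 1"
    and "v \<in> carrier (free_module A (b 0)) \<Longrightarrow> v 0 \<in> irrelevant_ideal A gr \<Longrightarrow>
      v \<in> D 0 ` carrier (free_module A (b 1))"
proof -
  let ?I = "irrelevant_ideal A gr"
  let ?F = "free_module A (b 0)"
  interpret I: ideal ?I A by (rule ideal_irrelevant)
  have e: "e \<in> graded_module_hom A ?F (shifted_free_grading gr 0 (b 0)) (quot_module A ?I) (quot_grading A gr ?I)"
    and D: "D 0 \<in> graded_module_hom A (free_module A (b (Suc 0))) (shifted_free_grading gr (Suc 0) (b (Suc 0)))
           ?F (shifted_free_grading gr 0 (b 0))"
    and surj: "e ` carrier ?F = carrier (quot_module A ?I)"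
    and ker: "D 0 ` carrier (free_module A (b 1)) = a_kernel ?F (quot_module A ?I) e"
    using res by (auto simp: linear_free_resolution_def)
  have kernel: "v \<in> D 0 ` carrier (free_module A (b 1))" if "v \<in> carrier ?F" "e v = ?I" for v
    using that unfolding ker by (simp add: a_kernel_def' quot_module_def FactRing_def)
  have kernel_mideal: "\<psi> (v j) \<in> mideal W" if v: "v \<in> carrier ?F" "e v = ?I" and j: "j < b 0" for v j
  proof -
    from kernel[OF v] obtain w where w: "w \<in> carrier (free_module A (b (Suc 0)))" "v = D 0 w"
      by auto
    have "\<psi> (w k) * \<psi> (D 0 (unit_vec (b (Suc 0)) k) j) \<in> mideal W" if "k < b (Suc 0)" for k
      using w(1) that hom_unit_scomp[OF D j] scomp_1_mideal
      by (intro mideal_mult psi_sring) (auto simp: free_module_def)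
    then show ?thesis
      unfolding w(2) hom_expand[OF D w(1) j] by (intro mideal_sum) auto
  qed
  have unit_not: "e (unit_vec (b 0) k) \<noteq> ?I" if "k < b 0" for k
  proof
    assume "e (unit_vec (b 0) k) = ?I"
    then have "\<psi> (unit_vec (b 0) k k) \<in> mideal W"
      using kernel_mideal that unit_vec_carrier by blast
    moreover have "unit_vec (b 0) k k = \<one>"
      using that by (simp add: unit_vec_def)
    ultimately have "\<one> \<in> ?I"
      unfolding irrelevant_ideal_eq by simp
    with one_notin_irrelevant show False ..
  qed
  have eu: "\<exists>a\<in>gr 0. e (unit_vec (b 0) k) = ?I +> a" for k
  proof -
    have "e ` shifted_free_grading gr 0 (b 0) 0 \<subseteq> quot_grading A gr ?I 0"
      using e unfolding graded_module_hom_def by blast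
    then have "e (unit_vec (b 0) k) \<in> quot_grading A gr ?I 0"
      using unit_vec_graded[of "b 0" k 0] by auto
    then show ?thesis
      by (auto simp: quot_grading_def)
  qed
  then have "\<forall>k. \<exists>a. a \<in> gr 0 \<and> e (unit_vec (b 0) k) = ?I +> a"
    by blast
  from choice[OF this] obtain a where a': "\<forall>k. a k \<in> gr 0 \<and> e (unit_vec (b 0) k) = ?I +> a k" ..
  then have a: "a k \<in> gr 0" "e (unit_vec (b 0) k) = ?I +> a k" for k
    by simp_all
  have a_carrier: "a k \<in> carrier A" for k
    using a(1) gr_carrier by blast
  have a_scomp: "\<psi> (a k) \<in> scomp 0" for k
    using a(1)[of k] gr_iff[of "a k" 0] by simp
  have e_smult: "e (c \<odot>\<^bsub>?F\<^esub> unit_vec (b 0) k) = ?I +> (c \<otimes> a k)" if "c \<in> carrier A" for c k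
  proof -
    have "e (c \<odot>\<^bsub>?F\<^esub> unit_vec (b 0) k) = c \<odot>\<^bsub>quot_module A ?I\<^esub> (?I +> a k)"
      using e that unit_vec_carrier a(2) by (auto simp: graded_module_hom_def)
    then show ?thesis
      using that a_carrier by (simp add: quot_module_def FactRing_def I.rcoset_mult_add)
  qed
  have "b 0 \<noteq> 0"
  proof
    assume "b 0 = 0"
    then have "carrier ?F = {\<lambda>_. undefined}"
      by (simp add: free_module_def)
    with surj have "carrier (quot_module A ?I) = {e (\<lambda>_. undefined)}"
      by simp
    moreover have "?I +> x \<in> carrier (quot_module A ?I)" if "x \<in> carrier A" for x
      using that by (auto simp: quot_module_def FactRing_def a_rcosetsI I.a_subset)
    from this[of \<one>] this[of \<zero>]
    have "?I +> \<one> \<in> carrier (quot_module A ?I)" "?I +> \<zero> \<in> carrier (quot_module A ?I)"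
      by blast+
    ultimately have "?I +> \<one> = ?I +> \<zero>"
      by blast
    then have "?I +> \<one> = ?I"
      by (simp add: I.a_rcos_const)
    then show False
      using I.a_rcos_self[of \<one>] one_notin_irrelevant by auto
  qed
  moreover have "\<not> 1 < b 0"
  proof
    assume b: "1 < b 0"
    \<comment> \<open>The combination \<open>?v \<oplus> ?w\<close> is killed by \<open>e\<close>.
      Its coordinate \<open>a 1\<close> is then a constant in the irrelevant ideal, hence zero,
      which would put the second basis vector into the kernel.\<close>
    let ?v = "a 1 \<odot>\<^bsub>?F\<^esub> unit_vec (b 0) 0"
    let ?w = "\<ominus> a 0 \<odot>\<^bsub>?F\<^esub> unit_vec (b 0) 1"
    have vw: "?v \<in> carrier ?F" "?w \<in> carrier ?F" "?v \<oplus>\<^bsub>?F\<^esub> ?w \<in> carrier ?F"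
      using a_carrier by (auto simp: free_module_def unit_vec_def)
    have "e (?v \<oplus>\<^bsub>?F\<^esub> ?w) = e ?v \<oplus>\<^bsub>quot_module A ?I\<^esub> e ?w"
      using e vw by (auto simp: graded_module_hom_def)
    also have "\<dots> = ?I +> (a 1 \<otimes> a 0 \<oplus> (\<ominus> a 0) \<otimes> a 1)"
      using a_carrier by (simp add: e_smult quot_module_def FactRing_def I.a_rcos_sum)
    also have "a 1 \<otimes> a 0 \<oplus> (\<ominus> a 0) \<otimes> a 1 = \<zero>"
      using a_carrier by (simp add: l_minus m_comm[of "a (Suc 0)" "a 0"] r_neg)
    finally have "e (?v \<oplus>\<^bsub>?F\<^esub> ?w) = ?I"
      by (simp add: I.a_rcos_const)
    with kernel_mideal[OF vw(3), of 0] b a_carrier have "\<psi> (a 1) \<in> mideal W"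
      by (simp add: free_module_def unit_vec_def)
    then have "a 1 = \<zero>"
      using scomp_0_mideal a_scomp psi_eq_0_iff a_carrier by blast
    then have "e (unit_vec (b 0) 1) = ?I"
      by (simp add: a(2) I.a_rcos_const)
    with unit_not b show False by blast
  qed
  ultimately show b0: "b 0 = 1"
    by simp
  assume v: "v \<in> carrier ?F" "v 0 \<in> ?I"
  have "v = v 0 \<odot>\<^bsub>?F\<^esub> unit_vec (b 0) 0"
    using v I.Icarr by (intro extensionalityI[of _ "{..<b 0}"]) (auto simp: free_module_def unit_vec_def b0 PiE_def)
  then have "e v = ?I +> (v 0 \<otimes> a 0)"
    using e_smult v I.Icarr by metis
  also have "\<dots> = ?I"
    using v I.I_r_closed a_carrier by (intro I.a_rcos_const) auto
  finally show "v \<in> D 0 ` carrier (free_module A (b 1))"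
    using kernel v by blast
qed

text \<open>\<open>P\<close> is a union of connected components of the graph that joins two
  variables when their product divides \<open>s\<close>. The two factorizations of \<open>s\<close>
  give a syzygy \<open>f\<close> of the variables with two terms. Exactness makes \<open>f\<close> a
  combination of linear syzygies, and restriction to \<open>P\<close> would keep just one of the two
  terms.\<close>

theorem koszul_imp_connected:
  assumes koszul: "koszul_algebra A gr"
    and s: "deg s \<ge> 3" and P: "P \<subseteq> W"
    and closed: "\<And>i j t. i \<in> P \<Longrightarrow> j \<in> W \<Longrightarrow> t \<in> S \<Longrightarrow> s = at i + at j + t \<Longrightarrow> j \<in> P"
    and p: "p \<in> P" "s1 \<in> S" "s = at p + s1"
    and q: "q \<in> W" "s2 \<in> S" "s = at q + s2"
  shows "q \<in> P"
proof (rule ccontr)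
  assume qP: "q \<notin> P"
  let ?I = "irrelevant_ideal A gr"
  obtain b D e where res: "linear_free_resolution A gr (quot_module A ?I) (quot_grading A gr ?I) b D e"
    using koszul by (auto simp: koszul_algebra_def has_linear_free_resolution_def)
  let ?F = "\<lambda>i. free_module A (b i)"
  have D: "D i \<in> graded_module_hom A (?F (Suc i)) (shifted_free_grading gr (Suc i) (b (Suc i)))
      (?F i) (shifted_free_grading gr i (b i))" for i
    using res by (auto simp: linear_free_resolution_def)
  have ker: "D (Suc 0) ` carrier (?F (Suc (Suc 0))) = a_kernel (?F (Suc 0)) (?F 0) (D 0)"
    using res by (auto simp: linear_free_resolution_def)
  note b0 = augmentation_rank(1)[OF res]
  define n where "n = b 1"
  define m where "m = b (Suc 1)"
  define l where "l k = \<psi> (D 0 (unit_vec n k) 0)" for k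
  define C where "C r k = \<psi> (D 1 (unit_vec m r) k)" for r k
  have D0: "\<psi> (D 0 v 0) = (\<Sum>k<n. \<psi> (v k) * l k)" if "v \<in> carrier (?F 1)" for v
    using hom_expand[OF D[of 0], of v 0] that by (simp add: b0 l_def n_def)
  have D1: "\<psi> (D 1 v k) = (\<Sum>r<m. \<psi> (v r) * C r k)" if "v \<in> carrier (?F (Suc 1))" "k < n" for v k
    using hom_expand[OF D[of 1], of v k] that by (simp add: C_def n_def m_def)
  have l: "l k \<in> scomp 1" for k
    using hom_unit_scomp[OF D[of 0], of 0 k] by (simp add: b0 l_def n_def)
  have C: "C r k \<in> scomp 1" if "k < n" for r k
    using hom_unit_scomp[OF D[of 1], of k r] that by (simp add: C_def n_def m_def)
  have ker_D0: "v \<in> D 1 ` carrier (?F (Suc 1)) \<longleftrightarrow> v \<in> carrier (?F 1) \<and> (\<Sum>k<n. \<psi> (v k) * l k) = 0" for v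
  proof -
    have "D 0 v = zero (?F 0) \<longleftrightarrow> D 0 v 0 = \<zero>" if "v \<in> carrier (?F 1)"
    proof -
      have "D 0 v \<in> carrier (?F 0)"
        using D[of 0] that by (auto simp: graded_module_hom_def)
      then show ?thesis
        by (auto simp: free_module_def b0 PiE_def extensional_def fun_eq_iff restrict_def)
    qed
    moreover have "D 0 v 0 = \<zero> \<longleftrightarrow> (\<Sum>k<n. \<psi> (v k) * l k) = 0" if "v \<in> carrier (?F 1)"
      using D0[OF that] psi_eq_0_iff[OF hom_carrier[OF D[of 0], of v 0]] that by (simp add: b0)
    ultimately show ?thesis
      using ker by (auto simp: a_kernel_def')
  qed
  \<comment> \<open>The forms \<open>l k\<close> generate the irrelevant ideal but may differ from
    the variables. Taking the degree 0 parts of the coefficients expresses each variable by them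
    with scalars.\<close>
  have ex_coeff: "\<exists>c. (\<Sum>k<n. Poly_Mapping.single 0 (c k) * l k) = X t" if t: "t \<in> W" for t
  proof -
    define v where "v = (\<lambda>j\<in>{..<b 0}. \<phi> (X t))"
    have Xt: "(X t :: 'g \<Rightarrow>\<^sub>0 'k) \<in> sring"
      by (rule X_sring[OF t])
    have v: "v \<in> carrier (?F 0)"
      using Xt by (auto simp: v_def free_module_def)
    have "v 0 \<in> ?I"
      using Xt X_mideal[OF t] by (simp add: v_def b0 irrelevant_ideal_eq)
    with augmentation_rank(2)[OF res v] obtain w where w: "w \<in> carrier (?F 1)" "v = D 0 w"
      by auto
    have "w \<in> {..<n} \<rightarrow>\<^sub>E carrier A"
      using w(1) by (simp add: free_module_def n_def)
    then have w_sring: "\<psi> (w k) \<in> sring" if "k < n" for k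
      using that by (meson PiE_mem lessThan_iff psi_sring)
    have "X t = \<psi> (v 0)"
      using Xt by (simp add: v_def b0)
    also have "\<dots> = (\<Sum>k<n. \<psi> (w k) * l k)"
      using D0[OF w(1)] w(2) by simp
    finally have eq: "X t = (\<Sum>k<n. \<psi> (w k) * l k)" .
    have "(X t :: 'g \<Rightarrow>\<^sub>0 'k) = hcomp (0 + 1) (X t)"
      by (simp add: hcomp_id[OF X_scomp[OF t], simplified])
    also have "\<dots> = (\<Sum>k<n. hcomp 0 (\<psi> (w k)) * l k)"
      unfolding eq hcomp_sum using w_sring l by (intro sum.cong refl hcomp_mult) auto
    also have "\<dots> = (\<Sum>k<n. Poly_Mapping.single 0 (Poly_Mapping.lookup (hcomp 0 (\<psi> (w k))) 0) * l k)"
      using scomp_0_eq[OF hcomp_scomp[OF w_sring]] by (intro sum.cong refl) auto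
    finally show ?thesis
      by (intro exI) (rule sym)
  qed
  then obtain c where c: "\<And>t. t \<in> W \<Longrightarrow> (\<Sum>k<n. Poly_Mapping.single 0 (c t k) * l k) = X t"
    by metis
  define d where "d k t = Poly_Mapping.lookup (l k) (at t)" for k t
  have l_eq: "l k = (\<Sum>t\<in>W. Poly_Mapping.single 0 (d k t) * X t)" for k
    unfolding d_def by (rule scomp_1_eq_sum[OF l])
  \<comment> \<open>The matrix product of \<open>c\<close> and \<open>d\<close> is the identity on
    \<open>W\<close>, so passing from \<open>f\<close> to \<open>h\<close> by \<open>c\<close> and
    back by \<open>d\<close> recovers \<open>f\<close>.\<close>
  have cd: "(\<Sum>k<n. c u k * d k t) = (if u = t then 1 else 0)" if "u \<in> W" "t \<in> W" for u t
  proof -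
    have "Poly_Mapping.lookup (X u) (at t) = (\<Sum>k<n. c u k * d k t)"
      unfolding c[OF that(1), symmetric] by (simp add: lookup_sum lookup_single_0_mult d_def)
    then show ?thesis
      using inj_on_eq_iff[OF inj_at that] by (simp add: X_def lookup_single when_def)
  qed
  define f :: "nat \<Rightarrow> 'g \<Rightarrow>\<^sub>0 'k"
    where "f t = (if t = p then Poly_Mapping.single s1 1 else if t = q then - Poly_Mapping.single s2 1 else 0)" for t
  have pq: "p \<in> W" "p \<noteq> q"
    using p P qP by auto
  have f_sring: "f t \<in> sring" for t
    using p q by (auto simp: f_def sring_def)
  have "(\<Sum>t\<in>W. f t * X t) = f p * X p + (f q * X q + (\<Sum>t\<in>W - {p} - {q}. f t * X t))"
    using finite_W pq q by (simp add: sum.remove[of W p] sum.remove[of "W - {p}" q])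
  also have "(\<Sum>t\<in>W - {p} - {q}. f t * X t) = 0"
    by (intro sum.neutral) (auto simp: f_def)
  also have "f p * X p + (f q * X q + 0) = Poly_Mapping.single s 1 - Poly_Mapping.single s 1"
    using pq p(3) q(3) by (simp add: f_def X_def mult_single add_ac)
  finally have f_syz: "(\<Sum>t\<in>W. f t * X t) = 0"
    by simp
  define h where "h k = (\<Sum>t\<in>W. f t * Poly_Mapping.single 0 (c t k))" for k
  have h_sring: "h k \<in> sring" for k
    unfolding h_def by (intro sring_sum sring_mult f_sring) (auto simp: sring_def zero_in)
  have "(\<Sum>k<n. h k * l k) = (\<Sum>t\<in>W. f t * (\<Sum>k<n. Poly_Mapping.single 0 (c t k) * l k))"
    unfolding h_def sum_distrib_right sum_distrib_left by (subst sum.swap) (simp add: mult.assoc)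
  also have "\<dots> = 0"
    using f_syz c by simp
  finally have h_syz: "(\<Sum>k<n. h k * l k) = 0" .
  define v where "v = (\<lambda>k\<in>{..<n}. \<phi> (h k))"
  have "v \<in> D 1 ` carrier (?F (Suc 1))"
    unfolding ker_D0 using h_sring h_syz by (auto simp: v_def free_module_def n_def)
  then obtain w where w: "w \<in> carrier (?F (Suc 1))" "v = D 1 w"
    by auto
  have h_eq: "h k = (\<Sum>r<m. \<psi> (w r) * C r k)" if "k < n" for k
  proof -
    have "\<psi> (v k) = h k"
      using that h_sring by (simp add: v_def)
    then show ?thesis
      using D1[OF w(1) that] w(2) by simp
  qed
  \<comment> \<open>The linear syzygies of the forms \<open>l k\<close> given by the second
    differential, rewritten by \<open>d\<close> as syzygies of the variables.\<close>
  define g where "g r t = (\<Sum>k<n. C r k * Poly_Mapping.single 0 (d k t))" for r t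
  have g_scomp: "g r t \<in> scomp 1" for r t
  proof -
    have "Poly_Mapping.single 0 (d k t) \<in> scomp 0" for k
      by (auto simp: scomp_def zero_in deg_zero)
    then show ?thesis
      unfolding g_def using scomp_mult[OF C] by (intro scomp_sum) fastforce
  qed
  have g_syz: "(\<Sum>t\<in>W. g r t * X t) = 0" for r
  proof -
    have "(\<Sum>t\<in>W. g r t * X t) = (\<Sum>k<n. C r k * l k)"
      unfolding g_def l_eq sum_distrib_right sum_distrib_left
      by (subst sum.swap) (simp add: mult.assoc)
    also have "\<dots> = 0"
      using ker_D0[of "D 1 (unit_vec m r)"] unit_vec_carrier[of m r] by (simp add: C_def m_def)
    finally show ?thesis .
  qed
  have "(\<Sum>k<n. h k * Poly_Mapping.single 0 (d k t)) = f t" if "t \<in> W" for t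
  proof -
    have "(\<Sum>k<n. h k * Poly_Mapping.single 0 (d k t))
        = (\<Sum>u\<in>W. f u * (\<Sum>k<n. Poly_Mapping.single 0 (c u k * d k t)))"
      unfolding h_def sum_distrib_right sum_distrib_left
      by (subst sum.swap) (simp add: mult.assoc mult_single)
    also have "\<dots> = (\<Sum>u\<in>W. f u * Poly_Mapping.single 0 (if u = t then 1 else 0))"
      using cd that by (intro sum.cong refl) (simp add: single_sum flip: cd)
    also have "\<dots> = (\<Sum>u\<in>W. if u = t then f u else 0)"
      by (intro sum.cong) auto
    finally show ?thesis
      using that finite_W by simp
  qed
  then have "(\<Sum>t\<in>P. f t * X t) = (\<Sum>t\<in>P. (\<Sum>k<n. h k * Poly_Mapping.single 0 (d k t)) * X t)"
    using P by (intro sum.cong) auto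
  also have "\<dots> = (\<Sum>t\<in>P. \<Sum>r<m. \<psi> (w r) * (g r t * X t))"
  proof (intro sum.cong refl)
    fix t
    have "(\<Sum>k<n. h k * Poly_Mapping.single 0 (d k t)) = (\<Sum>k<n. \<Sum>r<m. \<psi> (w r) * (C r k * Poly_Mapping.single 0 (d k t)))"
      using h_eq by (intro sum.cong refl) (simp add: sum_distrib_right mult.assoc)
    also have "\<dots> = (\<Sum>r<m. \<psi> (w r) * g r t)"
      unfolding g_def sum_distrib_left by (rule sum.swap)
    finally show "(\<Sum>k<n. h k * Poly_Mapping.single 0 (d k t)) * X t = (\<Sum>r<m. \<psi> (w r) * (g r t * X t))"
      by (simp add: sum_distrib_right mult.assoc)
  qed
  also have "\<dots> = (\<Sum>r<m. \<psi> (w r) * (\<Sum>t\<in>P. g r t * X t))"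
    by (subst sum.swap) (simp add: sum_distrib_left)
  finally have "Poly_Mapping.lookup (\<Sum>t\<in>P. f t * X t) s
      = (\<Sum>r<m. Poly_Mapping.lookup (\<psi> (w r) * (\<Sum>t\<in>P. g r t * X t)) s)"
    by (simp add: lookup_sum)
  also have "\<dots> = 0"
  proof (intro sum.neutral ballI)
    fix r assume "r \<in> {..<m}"
    moreover have "w \<in> {..<m} \<rightarrow>\<^sub>E carrier A"
      using w(1) by (simp add: free_module_def m_def)
    ultimately have "\<psi> (w r) \<in> sring"
      by (meson PiE_mem psi_sring)
    with s P closed g_scomp g_syz
    show "Poly_Mapping.lookup (\<psi> (w r) * (\<Sum>t\<in>P. g r t * X t)) s = 0"
      by (rule lookup_partial_syzygy)
  qed
  \<comment> \<open>As \<open>q\<close> lies outside \<open>P\<close>, only the term of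
    \<open>p\<close> survives; its coefficient at \<open>s\<close> is 1, against the 0 just
    obtained.\<close>
  also have "(\<Sum>t\<in>P. f t * X t) = (\<Sum>t\<in>P. if t = p then f p * X p else 0)"
    using qP by (intro sum.cong) (auto simp: f_def)
  also have "\<dots> = Poly_Mapping.single s 1"
    using p P finite_subset[OF P finite_W] by (simp add: f_def X_def mult_single add.commute)
  finally show False
    by simp
qed

end


section \<open>Sums of weights\<close>

inductive sums :: "nat set \<Rightarrow> nat \<Rightarrow> nat \<Rightarrow> bool" for W where
  sums_0: "sums W 0 0"
| sums_Suc: "a \<in> W \<Longrightarrow> sums W w d \<Longrightarrow> sums W (a + w) (Suc d)"

text \<open>The colon ideal \<open>(x\<^sub>r | r \<in> T) : x\<^sub>t\<close> is \<open>(x\<^sub>r | r \<in> T')\<close>.\<close>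

definition weight_colon :: "nat set \<Rightarrow> nat set \<Rightarrow> nat \<Rightarrow> nat set \<Rightarrow> bool"
  where "weight_colon W T t T' \<longleftrightarrow> (\<forall>w d. sums W w d \<longrightarrow>
    ((\<exists>r\<in>T. \<exists>w'. sums W w' d \<and> t + w = r + w') \<longleftrightarrow>
     (\<exists>r\<in>T'. \<exists>w' d'. sums W w' d' \<and> w = r + w' \<and> d = Suc d')))"

text \<open>The weights \<open>ws\<close> generate a flag of ideals; the \<open>k\<close>-th colon ideal is generated by the first
  \<open>cs ! k\<close> weights.\<close>

definition koszul_flag :: "nat set \<Rightarrow> nat list \<Rightarrow> nat list \<Rightarrow> bool"
  where "koszul_flag W ws cs \<longleftrightarrow> set ws = W \<and>
    (\<forall>k<length ws. weight_colon W (set (take k ws)) (ws ! k) (set (take (cs ! k) ws)))"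

lemma sums_bounded_deg:
  assumes "sums W w d" "\<And>a. a \<in> W \<Longrightarrow> a \<le> M"
  shows "w \<le> M * d"
  using assms by induction (auto intro: add_mono)

lemma sums_single: "a \<in> W \<Longrightarrow> sums W a 1"
  using sums_Suc[OF _ sums_0] by simp

lemma sums_add: "sums W w d \<Longrightarrow> sums W w' d' \<Longrightarrow> sums W (w + w') (d + d')"
  by (induction rule: sums.induct) (auto simp: add.assoc intro: sums_Suc)

lemma sums_deg_0: "sums W w 0 \<longleftrightarrow> w = 0"
  by (auto intro: sums_0 elim: sums.cases)

lemma sums_deg_1: "sums W w 1 \<longleftrightarrow> w \<in> W"
  by (auto simp: sums_deg_0 intro: sums_single[simplified] elim!: sums.cases[of _ _ "Suc 0"])

lemma sums_sum:
  "finite I \<Longrightarrow> (\<And>i. i \<in> I \<Longrightarrow> f i \<in> W) \<Longrightarrow> sums W (\<Sum>i\<in>I. c i * f i) (\<Sum>i\<in>I. c i)"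
proof (induction I rule: finite_induct)
  case (insert x I)
  have "sums W (k * f x) k" for k
    using insert.prems by (induction k) (auto intro: sums_0 sums_Suc)
  with insert show ?case
    by (auto intro: sums_add)
qed (simp add: sums_0)

text \<open>\<open>up\<close> puts every sum into \<open>Q\<close>, and \<open>down\<close> strips
  weights from a point of \<open>Q\<close> until degree 0. \<open>Q\<close> lives on integers to
  avoid truncated subtraction in conditions on \<open>M * d - w\<close>; for concrete weights all
  hypotheses become linear arithmetic.\<close>

lemma sums_iff:
  fixes Q :: "int \<Rightarrow> int \<Rightarrow> bool"
  assumes nonneg: "\<And>w d. Q w d \<Longrightarrow> 0 \<le> w"
    and zero: "\<And>w. Q w 0 \<longleftrightarrow> w = 0"
    and up: "\<And>w d. Q w d \<Longrightarrow> 0 \<le> d \<Longrightarrow> \<forall>a\<in>W. Q (w + int a) (d + 1)"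
    and down: "\<And>w d. Q w (d + 1) \<Longrightarrow> 0 \<le> d \<Longrightarrow> \<exists>a\<in>W. Q (w - int a) d"
  shows "sums W w d \<longleftrightarrow> Q (int w) (int d)"
proof
  show "Q (int w) (int d)" if "sums W w d"
    using that
  proof induction
    case (sums_Suc a w d)
    then show ?case
      using up[of "int w" "int d"] by (auto simp: add.commute)
  qed (simp add: zero)
  show "sums W w d" if "Q (int w) (int d)"
    using that
  proof (induction d arbitrary: w)
    case 0
    then show ?case
      by (simp add: zero sums_0)
  next
    case (Suc d)
    then obtain a where a: "a \<in> W" "Q (int w - int a) (int d)"
      using down[of "int w" "int d"] by (auto simp: add.commute)
    with nonneg have "int a \<le> int w"
      by fastforce
    with a Suc.IH[of "w - a"] have "sums W (w - a) d" "a \<le> w"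
      by (simp_all add: of_nat_diff)
    then show ?case
      using sums_Suc[OF a(1), of "w - a" d] by simp
  qed
qed

text \<open>\<open>colon\<close> bounds the colon ideal from above. \<open>step\<close> gives the
  converse on generators: \<open>t + r' = r + a\<close> is a quadratic relation showing that the
  product of the variables of \<open>t\<close> and \<open>r'\<close> lies in the ideal of
  \<open>T\<close>.\<close>

lemma weight_colonI:
  fixes Q :: "int \<Rightarrow> int \<Rightarrow> bool"
  assumes sums: "\<And>w d. sums W w d \<longleftrightarrow> Q (int w) (int d)"
    and nonneg: "\<And>w d. Q w d \<Longrightarrow> 0 \<le> w \<and> 0 \<le> d"
    and colon: "\<And>w d. Q w d \<Longrightarrow> \<exists>r\<in>T. Q (w + int t - int r) d \<Longrightarrow> \<exists>r\<in>T'. Q (w - int r) (d - 1)"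
    and step: "\<forall>r'\<in>T'. \<exists>r\<in>T. \<exists>a\<in>W. t + r' = r + a"
  shows "weight_colon W T t T'"
  unfolding weight_colon_def
proof (intro allI impI iffI)
  fix w d assume wd: "sums W w d" and "\<exists>r\<in>T. \<exists>w'. sums W w' d \<and> t + w = r + w'"
  then obtain r w' where r: "r \<in> T" "sums W w' d" "t + w = r + w'"
    by blast
  then have "Q (int w + int t - int r) (int d)"
    using sums by (metis add.commute add_diff_cancel_left' of_nat_add)
  with r wd obtain r' where r': "r' \<in> T'" "Q (int w - int r') (int d - 1)"
    using colon[of "int w" "int d"] sums by blast
  then have "r' \<le> w" "1 \<le> d"
    using nonneg[OF r'(2)] by simp_all
  with r'(2) have "sums W (w - r') (d - 1)"
    by (simp add: sums of_nat_diff)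
  with r'(1) \<open>r' \<le> w\<close> \<open>1 \<le> d\<close> show "\<exists>r\<in>T'. \<exists>w' d'. sums W w' d' \<and> w = r + w' \<and> d = Suc d'"
    by (intro bexI[of _ r'] exI[of _ "w - r'"] exI[of _ "d - 1"]) auto
next
  fix w d assume "\<exists>r\<in>T'. \<exists>w' d'. sums W w' d' \<and> w = r + w' \<and> d = Suc d'"
  then obtain r' w' d' where r': "r' \<in> T'" "sums W w' d'" "w = r' + w'" "d = Suc d'"
    by blast
  with step obtain r a where "r \<in> T" "a \<in> W" "t + r' = r + a"
    by blast
  with r' show "\<exists>r\<in>T. \<exists>w'. sums W w' d \<and> t + w = r + w'"
    by (intro bexI[of _ r] exI[of _ "a + w'"]) (auto intro: sums_Suc)
qed

lemma koszul_flagI: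
  fixes Q :: "int \<Rightarrow> int \<Rightarrow> bool" and ws :: "nat list"
  assumes ws_def: "ws = [a1, a2, a3, a4, a5]"
    and nonneg: "\<And>w d. Q w d \<Longrightarrow> 0 \<le> w \<and> 0 \<le> d"
    and zero: "\<And>w. Q w 0 \<longleftrightarrow> w = 0"
    and up: "\<And>w d. Q w d \<Longrightarrow> \<forall>a\<in>{a1, a2, a3, a4, a5}. Q (w + int a) (d + 1)"
    and down: "\<And>w d. Q w (d + 1) \<Longrightarrow> 0 \<le> d \<Longrightarrow> \<exists>a\<in>{a1, a2, a3, a4, a5}. Q (w - int a) d"
    and c2: "\<And>w d. Q w d \<Longrightarrow> \<exists>r\<in>{a1}. Q (w + int a2 - int r) d \<Longrightarrow>
      \<exists>r\<in>set (take n2 ws). Q (w - int r) (d - 1)"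
    and c3: "\<And>w d. Q w d \<Longrightarrow> \<exists>r\<in>{a1, a2}. Q (w + int a3 - int r) d \<Longrightarrow>
      \<exists>r\<in>set (take n3 ws). Q (w - int r) (d - 1)"
    and c4: "\<And>w d. Q w d \<Longrightarrow> \<exists>r\<in>{a1, a2, a3}. Q (w + int a4 - int r) d \<Longrightarrow>
      \<exists>r\<in>set (take n4 ws). Q (w - int r) (d - 1)"
    and c5: "\<And>w d. Q w d \<Longrightarrow> \<exists>r\<in>{a1, a2, a3, a4}. Q (w + int a5 - int r) d \<Longrightarrow>
      \<exists>r\<in>set (take n5 ws). Q (w - int r) (d - 1)"
    and b: "\<forall>r'\<in>set (take n2 ws). \<exists>r\<in>{a1}. \<exists>a\<in>set ws. a2 + r' = r + a"
      "\<forall>r'\<in>set (take n3 ws). \<exists>r\<in>{a1, a2}. \<exists>a\<in>set ws. a3 + r' = r + a"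
      "\<forall>r'\<in>set (take n4 ws). \<exists>r\<in>{a1, a2, a3}. \<exists>a\<in>set ws. a4 + r' = r + a"
      "\<forall>r'\<in>set (take n5 ws). \<exists>r\<in>{a1, a2, a3, a4}. \<exists>a\<in>set ws. a5 + r' = r + a"
  shows "koszul_flag {a1, a2, a3, a4, a5} ws [0, n2, n3, n4, n5]"
proof -
  let ?W = "{a1, a2, a3, a4, a5}"
  have sums: "sums ?W w d \<longleftrightarrow> Q (int w) (int d)" for w d
    using nonneg zero up down by (intro sums_iff) blast+
  have ws: "set ws = ?W"
    by (simp add: ws_def)
  have wc: "weight_colon ?W T t T'"
    if "\<And>w d. Q w d \<Longrightarrow> \<exists>r\<in>T. Q (w + int t - int r) d \<Longrightarrow> \<exists>r\<in>T'. Q (w - int r) (d - 1)"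
      and "\<forall>r'\<in>T'. \<exists>r\<in>T. \<exists>a\<in>?W. t + r' = r + a" for T t T'
    by (rule weight_colonI[where Q = Q]) (rule sums, erule nonneg, erule (1) that(1), rule that(2))
  \<comment> \<open>The colon of the zero ideal by a variable is zero, whence the leading 0 in the
    list of colon lengths.\<close>
  have "weight_colon ?W {} a1 (set (take 0 ws))"
    by (simp add: weight_colon_def)
  moreover have "weight_colon ?W {a1} a2 (set (take n2 ws))"
    by (rule wc[OF _ b(1)[unfolded ws]]) (erule (1) c2)
  moreover have "weight_colon ?W {a1, a2} a3 (set (take n3 ws))"
    by (rule wc[OF _ b(2)[unfolded ws]]) (erule (1) c3)
  moreover have "weight_colon ?W {a1, a2, a3} a4 (set (take n4 ws))"
    by (rule wc[OF _ b(3)[unfolded ws]]) (erule (1) c4)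
  moreover have "weight_colon ?W {a1, a2, a3, a4} a5 (set (take n5 ws))"
    by (rule wc[OF _ b(4)[unfolded ws]]) (erule (1) c5)
  ultimately show ?thesis
    by (auto simp: koszul_flag_def ws_def less_Suc_eq numeral_eq_Suc insert_commute)
qed

lemma take_lits:
  "take 1 (a # xs) = [a]" "take 2 (a # b # xs) = [a, b]" "take 3 (a # b # c # xs) = [a, b, c]"
  "take 4 (a # b # c # d # xs) = [a, b, c, d]" "take 5 (a # b # c # d # e # xs) = [a, b, c, d, e]"
  by (simp_all add: numeral_eq_Suc)

text \<open>For each of the fourteen weight sets, \<open>w\<close> is a sum of \<open>d\<close> weights if and only if neither \<open>w\<close> nor
  \<open>M * d - w\<close> is a gap of the numerical semigroup generated by the weights or by their complements
  to \<open>M\<close>, respectively (the curves are arithmetically Cohen-Macaulay); this is the predicate \<open>Q\<close>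
  below. The flags were found by computer search.\<close>

lemmas koszul_flag_eval = bex_simps ball_simps of_nat_numeral of_nat_0 of_nat_1 list.set take_lits

lemma koszul_flag_1_2_3_4: "koszul_flag {4, 3, 2, 1, 0} [4, 3, 2, 1, 0] [0, 4, 4, 4, 4]"
  by (rule koszul_flagI[OF refl, where Q = "\<lambda>w d. 0 \<le> w \<and> w \<le> 4 * d"])
    (simp_all only: koszul_flag_eval, (smt (z3))+, simp_all)

lemma koszul_flag_1_2_3_5: "koszul_flag {5, 0, 1, 2, 3} [5, 0, 1, 2, 3] [0, 1, 4, 5, 5]"
  by (rule koszul_flagI[OF refl, where Q = "\<lambda>w d. 0 \<le> w \<and> w \<le> 5 * d \<and> w + 1 \<noteq> 5 * d"])
    (simp_all only: koszul_flag_eval, (smt (z3))+, simp_all)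

lemma koszul_flag_1_2_3_6: "koszul_flag {0, 1, 2, 6, 3} [0, 1, 2, 6, 3] [0, 3, 3, 3, 5]"
  by (rule koszul_flagI[OF refl, where Q = "\<lambda>w d. 0 \<le> w \<and> w \<le> 6 * d \<and> w + 1 \<noteq> 6 * d \<and> w + 2 \<noteq> 6 * d"])
    (simp_all only: koszul_flag_eval, (smt (z3))+, simp_all)

lemma koszul_flag_1_2_4_6: "koszul_flag {0, 1, 6, 4, 2} [0, 1, 6, 4, 2] [0, 2, 2, 5, 5]"
  by (rule koszul_flagI[OF refl, where Q = "\<lambda>w d. 0 \<le> w \<and> w \<le> 6 * d \<and> w + 1 \<noteq> 6 * d \<and> w + 3 \<noteq> 6 * d"])
    (simp_all only: koszul_flag_eval, (smt (z3))+, simp_all)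

lemma koszul_flag_1_2_4_8: "koszul_flag {0, 1, 8, 4, 2} [0, 1, 8, 4, 2] [0, 2, 2, 4, 5]"
  by (rule koszul_flagI[OF refl, where Q = "\<lambda>w d. 0 \<le> w \<and> w \<le> 8 * d \<and> w + 1 \<noteq> 8 * d \<and> w + 2 \<noteq> 8 * d \<and> w + 3 \<noteq> 8 * d \<and> w + 5 \<noteq> 8 * d \<and> w + 9 \<noteq> 8 * d"])
    (simp_all only: koszul_flag_eval, (smt (z3))+, simp_all)

lemma koszul_flag_2_3_4_5: "koszul_flag {5, 0, 2, 3, 4} [5, 0, 2, 3, 4] [0, 1, 4, 5, 5]"
  by (rule koszul_flagI[OF refl, where Q = "\<lambda>w d. 0 \<le> w \<and> w \<le> 5 * d \<and> w \<noteq> 1"])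
    (simp_all only: koszul_flag_eval, (smt (z3))+, simp_all)

lemma koszul_flag_2_3_4_6: "koszul_flag {6, 0, 3, 4, 2} [6, 0, 3, 4, 2] [0, 1, 3, 5, 5]"
  by (rule koszul_flagI[OF refl, where Q = "\<lambda>w d. 0 \<le> w \<and> w \<le> 6 * d \<and> w \<noteq> 1 \<and> w + 1 \<noteq> 6 * d"])
    (simp_all only: koszul_flag_eval, (smt (z3))+, simp_all)

lemma koszul_flag_2_3_4_8: "koszul_flag {8, 4, 3, 0, 2} [8, 4, 3, 0, 2] [0, 2, 3, 3, 5]"
  by (rule koszul_flagI[OF refl, where Q = "\<lambda>w d. 0 \<le> w \<and> w \<le> 8 * d \<and> w \<noteq> 1 \<and> w + 1 \<noteq> 8 * d \<and> w + 2 \<noteq> 8 * d \<and> w + 3 \<noteq> 8 * d \<and> w + 7 \<noteq> 8 * d"])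
    (simp_all only: koszul_flag_eval, (smt (z3))+, simp_all)

lemma koszul_flag_2_4_5_6: "koszul_flag {6, 5, 0, 2, 4} [6, 5, 0, 2, 4] [0, 2, 2, 5, 5]"
  by (rule koszul_flagI[OF refl, where Q = "\<lambda>w d. 0 \<le> w \<and> w \<le> 6 * d \<and> w \<noteq> 1 \<and> w \<noteq> 3"])
    (simp_all only: koszul_flag_eval, (smt (z3))+, simp_all)

text \<open>The gaps are 1, 3 for the weights and 1, 2, 5 for their complements 3, 4, 6, 8. The
  entry 1 says that the variable of weight 0 is a nonzerodivisor modulo that of weight 8: a regular
  sequence, reflecting Cohen-Macaulayness.\<close>

lemma koszul_flag_2_4_5_8: "koszul_flag {8, 0, 4, 2, 5} [8, 0, 4, 2, 5] [0, 1, 3, 4, 5]"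
  by (rule koszul_flagI[OF refl, where Q = "\<lambda>w d. 0 \<le> w \<and> w \<le> 8 * d \<and> w \<noteq> 1 \<and> w \<noteq> 3 \<and> w + 1 \<noteq> 8 * d \<and> w + 2 \<noteq> 8 * d \<and> w + 5 \<noteq> 8 * d"])
    (simp_all only: koszul_flag_eval, (smt (z3))+, simp_all)

lemma koszul_flag_3_4_5_6: "koszul_flag {6, 3, 4, 5, 0} [6, 3, 4, 5, 0] [0, 2, 4, 4, 4]"
  by (rule koszul_flagI[OF refl, where Q = "\<lambda>w d. 0 \<le> w \<and> w \<le> 6 * d \<and> w \<noteq> 1 \<and> w \<noteq> 2"])
    (simp_all only: koszul_flag_eval, (smt (z3))+, simp_all)

lemma koszul_flag_3_4_6_8: "koszul_flag {0, 4, 6, 8, 3} [0, 4, 6, 8, 3] [0, 2, 3, 3, 5]"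
  by (rule koszul_flagI[OF refl, where Q = "\<lambda>w d. 0 \<le> w \<and> w \<le> 8 * d \<and> w \<noteq> 1 \<and> w \<noteq> 2 \<and> w \<noteq> 5 \<and> w + 1 \<noteq> 8 * d \<and> w + 3 \<noteq> 8 * d"])
    (simp_all only: koszul_flag_eval, (smt (z3))+, simp_all)

lemma koszul_flag_4_5_6_8: "koszul_flag {8, 6, 4, 5, 0} [8, 6, 4, 5, 0] [0, 2, 3, 4, 4]"
  by (rule koszul_flagI[OF refl, where Q = "\<lambda>w d. 0 \<le> w \<and> w \<le> 8 * d \<and> w \<noteq> 1 \<and> w \<noteq> 2 \<and> w \<noteq> 3 \<and> w \<noteq> 7 \<and> w + 1 \<noteq> 8 * d"])
    (simp_all only: koszul_flag_eval, (smt (z3))+, simp_all)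

lemma koszul_flag_4_6_7_8: "koszul_flag {0, 8, 7, 6, 4} [0, 8, 7, 6, 4] [0, 1, 3, 4, 5]"
  by (rule koszul_flagI[OF refl, where Q = "\<lambda>w d. 0 \<le> w \<and> w \<le> 8 * d \<and> w \<noteq> 1 \<and> w \<noteq> 2 \<and> w \<noteq> 3 \<and> w \<noteq> 5 \<and> w \<noteq> 9"])
    (simp_all only: koszul_flag_eval, (smt (z3))+, simp_all)


section \<open>The semigroup algebra of a projective monomial curve\<close>

text \<open>Exponents of \<open>u\<close> and \<open>v\<close> in the image of a product of
  \<open>d\<close> variables of total weight \<open>w\<close>; the bound
  \<open>w \<le> M * d\<close> keeps the subtraction honest.\<close>

definition point :: "nat \<Rightarrow> nat \<Rightarrow> nat \<Rightarrow> (nat \<Rightarrow>\<^sub>0 nat)"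
  where "point M w d = Poly_Mapping.single 1 w + Poly_Mapping.single 2 (M * d - w)"

lemma lookup_point: "Poly_Mapping.lookup (point M w d) 1 = w" "Poly_Mapping.lookup (point M w d) 2 = M * d - w"
  by (simp_all add: point_def lookup_add lookup_single when_def)

lemma point_eq_iff:
  assumes "w \<le> M * d" "w' \<le> M * d'" "0 < M"
  shows "point M w d = point M w' d' \<longleftrightarrow> w = w' \<and> d = d'"
proof
  assume eq: "point M w d = point M w' d'"
  have "w = w'" "M * d - w = M * d' - w'"
    using lookup_point[of M w d] lookup_point[of M w' d'] by (simp_all add: eq)
  with assms show "w = w' \<and> d = d'"
    by (metis le_add_diff_inverse mult_cancel1 not_gr_zero)
qed simp

lemma point_add: "w \<le> M * d \<Longrightarrow> w' \<le> M * d' \<Longrightarrow> point M w d + point M w' d' = point M (w + w') (d + d')"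
  unfolding point_def by (simp add: algebra_simps single_add flip: diff_add_assoc2)
    (simp add: add.assoc[symmetric] single_add[symmetric] diff_add_assoc)

lemma point_0: "point M 0 0 = 0"
  by (simp add: point_def)

lemma keys_point: "Poly_Mapping.keys (point M w d) \<subseteq> {1..2}"
  unfolding point_def
  using Poly_Mapping.keys_add[of "Poly_Mapping.single (1::nat) w" "Poly_Mapping.single 2 (M * d - w)"]
  by (force split: if_splits)

definition curve_semigroup :: "nat \<Rightarrow> nat set \<Rightarrow> (nat \<Rightarrow>\<^sub>0 nat) set"
  where "curve_semigroup M W = {point M w d | w d. sums W w d}"

text \<open>A product of \<open>d\<close> variables has an image of total degree
  \<open>M * d\<close> in \<open>u\<close> and \<open>v\<close>, hence the division.\<close>

definition curve_degree :: "nat \<Rightarrow> (nat \<Rightarrow>\<^sub>0 nat) \<Rightarrow> nat"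
  where "curve_degree M s = (Poly_Mapping.lookup s 1 + Poly_Mapping.lookup s 2) div M"

lemma curve_degree_point: "0 < M \<Longrightarrow> w \<le> M * d \<Longrightarrow> curve_degree M (point M w d) = d"
  by (simp add: curve_degree_def lookup_point[unfolded One_nat_def])

locale weight_set =
  fixes M :: nat and W :: "nat set"
  assumes finite_weights: "finite W" and M_pos: "0 < M" and bounded: "a \<in> W \<Longrightarrow> a \<le> M"
begin

lemma sums_le: "sums W w d \<Longrightarrow> w \<le> M * d"
  using sums_bounded_deg bounded by blast

lemma point_in: "sums W w d \<Longrightarrow> point M w d \<in> curve_semigroup M W"
  by (auto simp: curve_semigroup_def)

lemma sums_point_add: "sums W w d \<Longrightarrow> sums W w' d' \<Longrightarrow> point M w d + point M w' d' = point M (w + w') (d + d')"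
  by (intro point_add sums_le)

sublocale graded_semigroup "curve_semigroup M W" W "\<lambda>w. point M w (Suc 0)" "curve_degree M"
proof
  show "inj_on (\<lambda>w. point M w (Suc 0)) W"
    using point_eq_iff bounded M_pos by (auto simp: inj_on_def)
  show "0 \<in> curve_semigroup M W"
    using point_in[OF sums_0] by (simp add: point_0)
  show "point M w (Suc 0) \<in> curve_semigroup M W" if "w \<in> W" for w
    using point_in[OF sums_single[OF that, unfolded One_nat_def]] .
  show "s + t \<in> curve_semigroup M W" if "s \<in> curve_semigroup M W" "t \<in> curve_semigroup M W" for s t
    using that sums_point_add sums_add unfolding curve_semigroup_def by blast
  show "curve_degree M (s + t) = curve_degree M s + curve_degree M t"
    if "s \<in> curve_semigroup M W" "t \<in> curve_semigroup M W" for s t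
    using that M_pos sums_le sums_add
    by (auto simp: curve_semigroup_def sums_point_add curve_degree_point)
  show "curve_degree M (point M w (Suc 0)) = 1" if "w \<in> W" for w
    using that bounded M_pos by (simp add: curve_degree_point)
  show "\<exists>w\<in>W. \<exists>s'\<in>curve_semigroup M W. s = point M w (Suc 0) + s'"
    if "s \<in> curve_semigroup M W" "s \<noteq> 0" for s
  proof -
    from that obtain w d where wd: "sums W w d" "s = point M w d"
      by (auto simp: curve_semigroup_def)
    from wd(1) show ?thesis
    proof cases
      case sums_0
      with that wd point_0 show ?thesis by simp
    next
      case (sums_Suc a w' d')
      then have "s = point M a (Suc 0) + point M w' d'"
        using wd sums_point_add[OF sums_single[unfolded One_nat_def]] by simp
      with sums_Suc point_in show ?thesis by blast
    qed
  qed
qed (rule finite_weights)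

lemma divisible_point:
  assumes "sums W w d" "T \<subseteq> W"
  shows "point M w d \<in> divisible T \<longleftrightarrow> (\<exists>r\<in>T. \<exists>w' d'. sums W w' d' \<and> w = r + w' \<and> d = Suc d')"
proof
  assume "point M w d \<in> divisible T"
  then obtain r s where "r \<in> T" "s \<in> curve_semigroup M W" "point M w d = point M r (Suc 0) + s"
    by (auto simp: divisible_def)
  then obtain w' d' where r: "r \<in> T" "sums W w' d'" "point M w d = point M r (Suc 0) + point M w' d'"
    by (auto simp: curve_semigroup_def)
  then have "point M w d = point M (r + w') (1 + d')" "sums W (r + w') (1 + d')"
    using assms(2) sums_point_add[OF sums_single[unfolded One_nat_def]] sums_add[OF sums_single] by auto
  then have "w = r + w' \<and> d = 1 + d'"
    using point_eq_iff[of w M d "r + w'" "1 + d'"] assms(1) sums_le M_pos by blast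
  then have "w = r + w' \<and> d = Suc d'"
    by simp
  with r show "\<exists>r\<in>T. \<exists>w' d'. sums W w' d' \<and> w = r + w' \<and> d = Suc d'"
    by blast
next
  assume "\<exists>r\<in>T. \<exists>w' d'. sums W w' d' \<and> w = r + w' \<and> d = Suc d'"
  then obtain r w' d' where r: "r \<in> T" "sums W w' d'" "w = r + w'" "d = Suc d'"
    by blast
  then have "point M w d = point M r (Suc 0) + point M w' d'"
    using assms(2) sums_point_add[OF sums_single[unfolded One_nat_def]] by auto
  with r point_in show "point M w d \<in> divisible T"
    unfolding divisible_def by blast
qed

text \<open>Multiplying by \<open>t\<close> and cancelling \<open>r\<close> preserves the degree,
  which is why \<open>w\<close> and \<open>w'\<close> share \<open>d\<close> on the left of
  \<open>weight_colon\<close>; on the right only a division takes place and the degree drops by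
  one.\<close>

lemma colon_weight_colon:
  assumes "weight_colon W T t T'" "t \<in> W" "T \<subseteq> W" "T' \<subseteq> W"
  shows "colon T t T'"
  unfolding colon_def
proof
  fix s assume "s \<in> curve_semigroup M W"
  then obtain w d where wd: "sums W w d" "s = point M w d"
    by (auto simp: curve_semigroup_def)
  have "point M t (Suc 0) + s = point M (t + w) (Suc d)" "sums W (t + w) (Suc d)"
    using wd assms(2) sums_point_add[OF sums_single[unfolded One_nat_def]] sums_Suc by auto
  then show "point M t (Suc 0) + s \<in> divisible T \<longleftrightarrow> s \<in> divisible T'"
    using assms wd by (auto simp: divisible_point weight_colon_def)
qed

text \<open>The flag runs from the zero ideal to the irrelevant ideal. Its colon ideals are again
  prefixes of \<open>ws\<close>, so every member is well ordered by its own prefix.\<close>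

lemma koszul_flag_filtration:
  assumes "koszul_flag W ws cs"
  shows "koszul_filtration {set (take k ws) | k. True}"
proof -
  have ws: "set ws = W"
    using assms by (simp add: koszul_flag_def)
  have sub: "set (take k ws) \<subseteq> W" for k
    using set_take_subset ws by fast
  have "good_order {set (take k ws) | k. True} (take k ws)" for k
    unfolding good_order_def
  proof (intro conjI allI impI sub)
    fix j assume "j < length (take k ws)"
    then have j: "j < length ws" "j < k" by auto
    then have "colon (set (take j ws)) (ws ! j) (set (take (cs ! j) ws))"
      using assms ws sub by (intro colon_weight_colon) (auto simp: koszul_flag_def)
    with j sub show "\<exists>T\<in>{set (take k ws) | k. True}. T \<subseteq> W \<and>
        colon (set (take j (take k ws))) (take k ws ! j) T"
      by (auto simp: min_def)
  qed
  moreover have "W = set (take (length ws) ws)"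
    by (simp add: ws)
  ultimately show ?thesis
    unfolding koszul_filtration_def by blast
qed

end

section \<open>Polynomial rings and the substitution homomorphism\<close>

lemma mvar_power: "mvar i ^ k = Poly_Mapping.single (Poly_Mapping.single i k) (1 :: 'k::field)"
  by (induction k) (simp_all add: mvar_def mult_single flip: single_add)

lemma single_point_power:
  assumes "w \<le> M * d"
  shows "Poly_Mapping.single (point M w d) (1 :: 'k::field) ^ k = Poly_Mapping.single (point M (k * w) (k * d)) 1"
proof (induction k)
  case (Suc k)
  have "k * w \<le> M * (k * d)"
    using assms by (metis mult.left_commute mult_le_mono2)
  with Suc assms show ?case
    by (simp add: mult_single point_add)
qed (simp add: point_0)

lemma prod_single_point:
  assumes "finite I" "\<And>i. i \<in> I \<Longrightarrow> w i \<le> M * d i"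
  shows "(\<Prod>i\<in>I. Poly_Mapping.single (point M (w i) (d i)) (1 :: 'k::field))
    = Poly_Mapping.single (point M (sum w I) (sum d I)) 1"
  using assms
proof (induction I rule: finite_induct)
  case (insert x I)
  have "sum w I \<le> M * sum d I"
    using insert.prems by (auto simp: sum_distrib_left intro!: sum_mono)
  with insert show ?case
    by (simp add: mult_single point_add)
qed (simp add: point_0)

lemma mpoly_cring: "cring (mpoly_ring N :: 'k::field mpoly ring)"
proof -
  have add: "p + q \<in> carrier (mpoly_ring N)" if "p \<in> carrier (mpoly_ring N)" "q \<in> carrier (mpoly_ring N)"
    for p q :: "'k mpoly"
    using that Poly_Mapping.keys_add[of p q] by (auto simp: mpoly_ring_def)
  have mult: "p * q \<in> carrier (mpoly_ring N)" if "p \<in> carrier (mpoly_ring N)" "q \<in> carrier (mpoly_ring N)"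
    for p q :: "'k mpoly"
  proof -
    have "Poly_Mapping.keys t \<subseteq> {1..N}" if t: "t \<in> Poly_Mapping.keys (p * q)" for t
    proof -
      obtain a b where "t = a + b" "a \<in> Poly_Mapping.keys p" "b \<in> Poly_Mapping.keys q"
        using Poly_Mapping.keys_mult[of p q] t by blast
      then show ?thesis
        using Poly_Mapping.keys_add[of a b] \<open>p \<in> _\<close> \<open>q \<in> _\<close> by (force simp: mpoly_ring_def)
    qed
    then show ?thesis
      by (simp add: mpoly_ring_def)
  qed
  have uminus: "- p \<in> carrier (mpoly_ring N)" if "p \<in> carrier (mpoly_ring N)" for p :: "'k mpoly"
    using that by (simp add: mpoly_ring_def)
  have zero_one: "(0 :: 'k mpoly) \<in> carrier (mpoly_ring N)" "(1 :: 'k mpoly) \<in> carrier (mpoly_ring N)"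
    by (auto simp: mpoly_ring_def)
  have simps: "\<And>p q :: 'k mpoly. p \<oplus>\<^bsub>mpoly_ring N\<^esub> q = p + q" "\<And>p q :: 'k mpoly. p \<otimes>\<^bsub>mpoly_ring N\<^esub> q = p * q"
    "\<zero>\<^bsub>mpoly_ring N\<^esub> = (0 :: 'k mpoly)" "\<one>\<^bsub>mpoly_ring N\<^esub> = (1 :: 'k mpoly)"
    by (simp_all add: mpoly_ring_def)
  show ?thesis
  proof (rule cringI)
    show "abelian_group (mpoly_ring N :: 'k mpoly ring)"
      using add uminus zero_one
      by (intro abelian_groupI) (auto simp: simps add_ac intro!: bexI[of _ "- _"])
    show "Group.comm_monoid (mpoly_ring N :: 'k mpoly ring)"
      using mult zero_one by (intro comm_monoidI) (auto simp: simps mult_ac)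
  qed (auto simp: simps distrib_right)
qed

locale monomial_curve =
  fixes n :: nat and m :: "nat \<Rightarrow> nat"
  assumes m_pos: "0 < m n" and m_le: "i \<in> {1..n} \<Longrightarrow> m i \<le> m n"
begin

definition weights :: "nat set"
  where "weights = insert 0 (m ` {1..n})"

sublocale weight_set "m n" weights
  using m_pos m_le by unfold_locales (auto simp: weights_def)

text \<open>The last variable maps to a power of \<open>v\<close> alone and so gets weight
  0.\<close>

definition wt :: "nat \<Rightarrow> nat"
  where "wt i = (if i = Suc n then 0 else m i)"

definition wsum :: "(nat \<Rightarrow>\<^sub>0 nat) \<Rightarrow> nat"
  where "wsum t = (\<Sum>i=Suc 0..Suc n. Poly_Mapping.lookup t i * wt i)"

definition dsum :: "(nat \<Rightarrow>\<^sub>0 nat) \<Rightarrow> nat"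
  where "dsum t = (\<Sum>i=Suc 0..Suc n. Poly_Mapping.lookup t i)"

text \<open>On monomials in \<open>x_1, ..., x_(n+1)\<close> the substitution acts on exponents by
  this additive map.\<close>

definition \<epsilon> :: "(nat \<Rightarrow>\<^sub>0 nat) \<Rightarrow> (nat \<Rightarrow>\<^sub>0 nat)"
  where "\<epsilon> t = point (m n) (wsum t) (dsum t)"

lemma wt_weights: "i \<in> {Suc 0..Suc n} \<Longrightarrow> wt i \<in> weights"
  by (auto simp: wt_def weights_def le_Suc_eq)

lemma wt_le: "i \<in> {Suc 0..Suc n} \<Longrightarrow> wt i \<le> m n"
  using wt_weights bounded by blast

lemma dsum_monom_degree: "Poly_Mapping.keys t \<subseteq> {Suc 0..Suc n} \<Longrightarrow> monom_degree t = dsum t"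
  unfolding monom_degree_def dsum_def by (intro sum.mono_neutral_left) (auto simp: in_keys_iff)

lemma sums_wsum: "sums weights (wsum t) (dsum t)"
  unfolding wsum_def dsum_def by (rule sums_sum) (auto intro: wt_weights[simplified])

lemma \<epsilon>_in: "\<epsilon> t \<in> curve_semigroup (m n) weights"
  unfolding \<epsilon>_def by (rule point_in[OF sums_wsum])

lemma \<epsilon>_add: "\<epsilon> (s + t) = \<epsilon> s + \<epsilon> t"
  unfolding \<epsilon>_def sums_point_add[OF sums_wsum sums_wsum]
  by (simp add: wsum_def dsum_def lookup_add algebra_simps sum.distrib)

lemma degree_\<epsilon>: "curve_degree (m n) (\<epsilon> t) = dsum t"
  unfolding \<epsilon>_def using curve_degree_point[OF m_pos] sums_le[OF sums_wsum] by blast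

lemma \<epsilon>_surj:
  assumes "s \<in> curve_semigroup (m n) weights"
  shows "\<exists>t. Poly_Mapping.keys t \<subseteq> {Suc 0..Suc n} \<and> \<epsilon> t = s"
proof -
  have "\<exists>t. Poly_Mapping.keys t \<subseteq> {Suc 0..Suc n} \<and> wsum t = w \<and> dsum t = d" if "sums weights w d" for w d
    using that
  proof induction
    case sums_0
    then show ?case
      by (intro exI[of _ 0]) (auto simp: wsum_def dsum_def)
  next
    case (sums_Suc a w d)
    then obtain t where t: "Poly_Mapping.keys t \<subseteq> {Suc 0..Suc n}" "wsum t = w" "dsum t = d"
      by blast
    from sums_Suc(1) obtain i where i: "i \<in> {Suc 0..Suc n}" "wt i = a"
      unfolding weights_def wt_def by fastforce
    let ?t = "Poly_Mapping.single i 1 + t"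
    have "Poly_Mapping.keys ?t \<subseteq> {Suc 0..Suc n}"
      using Poly_Mapping.keys_add[of "Poly_Mapping.single i 1" t] t i by auto
    moreover have "wsum ?t = a + w" "dsum ?t = Suc d"
      using t i by (auto simp: wsum_def dsum_def lookup_add lookup_single when_def algebra_simps sum.distrib
          if_distrib[of "\<lambda>x. _ * x"] cong: if_cong)
    ultimately show ?case by blast
  qed
  with assms show ?thesis
    unfolding curve_semigroup_def \<epsilon>_def by blast
qed

lemma curve_param_eq:
  assumes "i \<in> {Suc 0..Suc n}"
  shows "curve_param n m i = Poly_Mapping.single (point (m n) (wt i) (Suc 0)) (1 :: 'k::field)"
  by (auto simp: curve_param_def mvar_power mult_single point_def wt_def)

lemma monomial_subst:
  assumes "Poly_Mapping.keys t \<subseteq> {Suc 0..Suc n}"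
  shows "(\<Prod>i\<in>Poly_Mapping.keys t. curve_param n m i ^ Poly_Mapping.lookup t i)
    = Poly_Mapping.single (\<epsilon> t) (1 :: 'k::field)"
proof -
  have "(\<Prod>i\<in>Poly_Mapping.keys t. curve_param n m i ^ Poly_Mapping.lookup t i)
      = (\<Prod>i\<in>Poly_Mapping.keys t. Poly_Mapping.single (point (m n) (Poly_Mapping.lookup t i * wt i) (Poly_Mapping.lookup t i)) (1 :: 'k))"
  proof (intro prod.cong refl)
    fix i assume "i \<in> Poly_Mapping.keys t"
    then have i: "i \<in> {Suc 0..Suc n}" using assms by auto
    show "curve_param n m i ^ Poly_Mapping.lookup t i =
        Poly_Mapping.single (point (m n) (Poly_Mapping.lookup t i * wt i) (Poly_Mapping.lookup t i)) (1 :: 'k)"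
      unfolding curve_param_eq[OF i] using wt_le[OF i] by (subst single_point_power) auto
  qed
  also have "\<dots> = Poly_Mapping.single (point (m n)
      (\<Sum>i\<in>Poly_Mapping.keys t. Poly_Mapping.lookup t i * wt i) (\<Sum>i\<in>Poly_Mapping.keys t. Poly_Mapping.lookup t i)) 1"
    using wt_le assms by (intro prod_single_point) (auto simp: mult.commute)
  also have "(\<Sum>i\<in>Poly_Mapping.keys t. Poly_Mapping.lookup t i * wt i) = wsum t"
    unfolding wsum_def using assms by (intro sum.mono_neutral_left) (auto simp: in_keys_iff)
  also have "(\<Sum>i\<in>Poly_Mapping.keys t. Poly_Mapping.lookup t i) = dsum t"
    unfolding dsum_def using assms by (intro sum.mono_neutral_left) (auto simp: in_keys_iff)
  finally show ?thesis
    by (simp add: \<epsilon>_def)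
qed

abbreviation R :: "'k::field mpoly ring"
  where "R \<equiv> mpoly_ring (Suc n)"

abbreviation h :: "'k::field mpoly \<Rightarrow> 'k mpoly"
  where "h \<equiv> mpoly_subst (curve_param n m)"

text \<open>Allowing any finite \<open>K\<close> around the support lets \<open>h_add\<close> expand
  three polynomials over one index set.\<close>

lemma h_eq:
  assumes "p \<in> carrier R" "finite K" "Poly_Mapping.keys p \<subseteq> K"
  shows "h p = (\<Sum>t\<in>K. Poly_Mapping.single (\<epsilon> t) (Poly_Mapping.lookup p t))"
proof -
  have "h p = (\<Sum>t\<in>Poly_Mapping.keys p. Poly_Mapping.single (\<epsilon> t) (Poly_Mapping.lookup p t))"
    unfolding mpoly_subst_def
  proof (intro sum.cong refl)
    fix t assume "t \<in> Poly_Mapping.keys p"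
    then have "Poly_Mapping.keys t \<subseteq> {Suc 0..Suc n}"
      using assms(1) by (auto simp: mpoly_ring_def)
    then show "mconst (Poly_Mapping.lookup p t) * (\<Prod>i\<in>Poly_Mapping.keys t. curve_param n m i ^ Poly_Mapping.lookup t i)
        = Poly_Mapping.single (\<epsilon> t) (Poly_Mapping.lookup p t)"
      by (simp add: monomial_subst mconst_def mult_single)
  qed
  also have "\<dots> = (\<Sum>t\<in>K. Poly_Mapping.single (\<epsilon> t) (Poly_Mapping.lookup p t))"
    using assms(2,3) by (intro sum.mono_neutral_left) (auto simp: in_keys_iff)
  finally show ?thesis .
qed

interpretation R: cring "R :: 'k::field mpoly ring"
  by (rule mpoly_cring)

lemma R_simps: "p \<oplus>\<^bsub>R\<^esub> q = p + q" "p \<otimes>\<^bsub>R\<^esub> q = p * q" "\<zero>\<^bsub>R\<^esub> = 0" "\<one>\<^bsub>R\<^esub> = 1"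
  by (simp_all add: mpoly_ring_def)

lemma h_add:
  assumes "p \<in> carrier R" "q \<in> carrier R"
  shows "h (p + q) = h p + h q"
proof -
  let ?K = "Poly_Mapping.keys p \<union> Poly_Mapping.keys q"
  have "p + q \<in> carrier R"
    using R.a_closed[OF assms] by (simp add: R_simps)
  then show ?thesis
    using assms h_eq[of p ?K] h_eq[of q ?K] h_eq[of "p + q" ?K] Poly_Mapping.keys_add[of p q]
    by (simp add: lookup_add single_add sum.distrib)
qed

lemma single_in_R: "Poly_Mapping.keys t \<subseteq> {Suc 0..Suc n} \<Longrightarrow> Poly_Mapping.single t c \<in> carrier R"
  by (simp add: mpoly_ring_def)

lemma h_single: "Poly_Mapping.keys t \<subseteq> {Suc 0..Suc n} \<Longrightarrow> h (Poly_Mapping.single t c) = Poly_Mapping.single (\<epsilon> t) c"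
  using h_eq[OF single_in_R, of t "{t}" c] by simp

lemma sum_in_R: "(\<And>i. i \<in> I \<Longrightarrow> f i \<in> carrier R) \<Longrightarrow> sum f I \<in> carrier R"
proof (induction I rule: infinite_finite_induct)
  case (insert x I)
  then show ?case
    using R.a_closed[of "f x" "sum f I"] by (simp add: R_simps)
qed (auto simp: mpoly_ring_def)

lemma h_sum: "finite I \<Longrightarrow> (\<And>i. i \<in> I \<Longrightarrow> f i \<in> carrier R) \<Longrightarrow> h (sum f I) = (\<Sum>i\<in>I. h (f i))"
proof (induction I rule: finite_induct)
  case (insert x I)
  then show ?case
    by (simp add: h_add sum_in_R)
qed (simp add: mpoly_subst_def)

lemma h_mult:
  assumes p: "p \<in> carrier R" and q: "q \<in> carrier R"
  shows "h (p * q) = h p * h q"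
proof -
  let ?K = "Poly_Mapping.keys p" and ?L = "Poly_Mapping.keys q"
  have kp: "Poly_Mapping.keys t \<subseteq> {Suc 0..Suc n}" if "t \<in> ?K" for t
    using p that by (auto simp: mpoly_ring_def)
  have kq: "Poly_Mapping.keys t \<subseteq> {Suc 0..Suc n}" if "t \<in> ?L" for t
    using q that by (auto simp: mpoly_ring_def)
  have kpq: "Poly_Mapping.keys (s + t) \<subseteq> {Suc 0..Suc n}" if "s \<in> ?K" "t \<in> ?L" for s t
    using Poly_Mapping.keys_add[of s t] kp[OF that(1)] kq[OF that(2)] by blast
  have "p * q = (\<Sum>s\<in>?K. \<Sum>t\<in>?L. Poly_Mapping.single (s + t) (Poly_Mapping.lookup p s * Poly_Mapping.lookup q t))"
  proof -
    have "p * q = (\<Sum>s\<in>?K. Poly_Mapping.single s (Poly_Mapping.lookup p s)) * (\<Sum>t\<in>?L. Poly_Mapping.single t (Poly_Mapping.lookup q t))"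
      using poly_mapping_eq_sum_single by metis
    then show ?thesis
      by (simp add: sum_product mult_single)
  qed
  then have "h (p * q) = (\<Sum>s\<in>?K. \<Sum>t\<in>?L. Poly_Mapping.single (\<epsilon> (s + t)) (Poly_Mapping.lookup p s * Poly_Mapping.lookup q t))"
    using kpq by (simp add: h_sum sum_in_R single_in_R h_single)
  also have "\<dots> = h p * h q"
    by (simp add: h_eq[OF p finite_keys order.refl] h_eq[OF q finite_keys order.refl] sum_product mult_single \<epsilon>_add)
  finally show ?thesis .
qed

text \<open>A preimage monomial is chosen for each monomial in the support. Since
  \<open>\<epsilon>\<close> respects degrees, homogeneous elements lift to homogeneous polynomials,
  which identifies the quotient grading.\<close>

lemma h_image: "h ` carrier R = (sring :: 'k::field mpoly set)"
  and h_graded_preimage: "q \<in> sring \<Longrightarrow> \<forall>s\<in>Poly_Mapping.keys q. curve_degree (m n) s = d \<Longrightarrow>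
    \<exists>p\<in>mpoly_grading (Suc n) (int d). h p = (q :: 'k mpoly)"
proof -
  have sub: "h p \<in> sring" if "p \<in> carrier R" for p :: "'k mpoly"
    unfolding h_eq[OF that finite_keys order.refl]
    by (rule sring_sum) (auto simp: sring_def \<epsilon>_in)
  have pre: "\<exists>p\<in>carrier R. h p = q \<and> (\<forall>t\<in>Poly_Mapping.keys p. \<epsilon> t \<in> Poly_Mapping.keys q)"
    if q: "q \<in> sring" for q :: "'k mpoly"
  proof -
    have "\<forall>s\<in>Poly_Mapping.keys q. \<exists>t. Poly_Mapping.keys t \<subseteq> {Suc 0..Suc n} \<and> \<epsilon> t = s"
      using q \<epsilon>_surj unfolding sring_def by blast
    then obtain \<tau> where \<tau>: "\<And>s. s \<in> Poly_Mapping.keys q \<Longrightarrow> Poly_Mapping.keys (\<tau> s) \<subseteq> {Suc 0..Suc n} \<and> \<epsilon> (\<tau> s) = s"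
      by metis
    define p where "p = (\<Sum>s\<in>Poly_Mapping.keys q. Poly_Mapping.single (\<tau> s) (Poly_Mapping.lookup q s))"
    have "p \<in> carrier R"
      unfolding p_def using \<tau> by (intro sum_in_R single_in_R) blast
    moreover have "h p = q"
    proof -
      have "h p = (\<Sum>s\<in>Poly_Mapping.keys q. Poly_Mapping.single (\<epsilon> (\<tau> s)) (Poly_Mapping.lookup q s))"
        unfolding p_def using \<tau> by (subst h_sum) (use \<tau> in \<open>auto intro!: single_in_R sum.cong simp: h_single\<close>)
      also have "\<dots> = (\<Sum>s\<in>Poly_Mapping.keys q. Poly_Mapping.single s (Poly_Mapping.lookup q s))"
        using \<tau> by (intro sum.cong) auto
      finally show ?thesis
        using poly_mapping_eq_sum_single by metis
    qed
    moreover have "Poly_Mapping.keys p \<subseteq> \<tau> ` Poly_Mapping.keys q"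
      unfolding p_def using Poly_Mapping.keys_sum[of "\<lambda>s. Poly_Mapping.single (\<tau> s) (Poly_Mapping.lookup q s)"]
      by (fastforce split: if_splits)
    ultimately show ?thesis
      using \<tau> by (intro bexI[of _ p]) auto
  qed
  show "h ` carrier R = (sring :: 'k mpoly set)"
    using sub pre by blast
  show "\<exists>p\<in>mpoly_grading (Suc n) (int d). h p = q"
    if "q \<in> sring" "\<forall>s\<in>Poly_Mapping.keys q. curve_degree (m n) s = d" for q :: "'k mpoly" and d
  proof -
    from pre[OF that(1)] obtain p where p: "p \<in> carrier R" "h p = q"
      "\<forall>t\<in>Poly_Mapping.keys p. \<epsilon> t \<in> Poly_Mapping.keys q" by blast
    have "monom_degree t = d" if "t \<in> Poly_Mapping.keys p" for t
      using p that \<open>\<forall>s\<in>Poly_Mapping.keys q. _\<close> degree_\<epsilon>[of t] dsum_monom_degree[of t]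
      by (auto simp: mpoly_ring_def)
    with p show ?thesis
      by (intro bexI[of _ p]) (auto simp: mpoly_grading_def)
  qed
qed

lemma h_ring_hom: "ring_hom_ring R (mpoly_ring 2) (h :: 'k::field mpoly \<Rightarrow> 'k mpoly)"
proof (rule ring_hom_ringI)
  show "h p \<in> carrier (mpoly_ring 2)" if "p \<in> carrier R" for p :: "'k mpoly"
  proof -
    have "h p \<in> sring"
      using h_image that by blast
    then have "Poly_Mapping.keys t \<subseteq> {1..2}" if "t \<in> Poly_Mapping.keys (h p)" for t
    proof -
      have "t \<in> curve_semigroup (m n) weights"
        using that \<open>h p \<in> sring\<close> unfolding sring_def by blast
      then show ?thesis
        using keys_point by (auto simp only: curve_semigroup_def mem_Collect_eq)
    qed
    then show ?thesis
      by (simp add: mpoly_ring_def)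
  qed
  show "ring (R :: 'k mpoly ring)" "ring (mpoly_ring 2 :: 'k mpoly ring)"
    by (rule cring.axioms(1)[OF mpoly_cring])+
  show "h \<one>\<^bsub>R\<^esub> = (\<one>\<^bsub>mpoly_ring 2\<^esub> :: 'k mpoly)"
    by (simp add: mpoly_ring_def mpoly_subst_def mconst_def)
qed (auto simp: R_simps h_mult h_add mpoly_ring_def[of 2])

text \<open>The map of the first isomorphism theorem: \<open>h\<close> is constant on a coset of its
  kernel, so the image of the coset is a singleton.\<close>

definition \<psi> :: "'k::field mpoly set \<Rightarrow> 'k mpoly"
  where "\<psi> Y = the_elem (h ` Y)"

theorem semigroup_algebra_curve:
  "semigroup_algebra (curve_semigroup (m n) weights) weights (\<lambda>w. point (m n) w (Suc 0)) (curve_degree (m n))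
    (curve_ring n m :: 'k::field mpoly set ring) (curve_ring_grading n m) \<psi>"
proof -
  interpret hom: ring_hom_ring "R :: 'k mpoly ring" "mpoly_ring 2" h
    by (rule h_ring_hom)
  let ?I = "curve_ideal n m :: 'k mpoly set"
  let ?A = "curve_ring n m :: 'k mpoly set ring"
  have I: "?I = a_kernel R (mpoly_ring 2) h"
    by (simp add: curve_ideal_def)
  have A: "?A = R Quot a_kernel R (mpoly_ring 2) h"
    by (simp add: curve_ring_def I)
  interpret A: cring ?A
    unfolding A by (rule ideal.quotient_is_cring[OF hom.kernel_is_ideal R.cring_axioms])
  have hom: "\<psi> \<in> ring_hom ?A (mpoly_ring 2)"
    unfolding A \<psi>_def[abs_def] by (rule hom.the_elem_hom)
  have psi_coset: "\<psi> (?I +>\<^bsub>R\<^esub> p) = h p" if "p \<in> carrier R" for p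
    unfolding \<psi>_def I using that by (rule hom.the_elem_simp)
  have inj: "inj_on \<psi> (carrier ?A)"
    unfolding A \<psi>_def[abs_def] by (intro inj_onI hom.the_elem_inj)
  have image: "\<psi> ` carrier ?A = sring"
    unfolding A \<psi>_def[abs_def] hom.the_elem_surj by (rule h_image)
  have coset_A: "?I +>\<^bsub>R\<^esub> p \<in> carrier ?A" if "p \<in> carrier R" for p
    using that unfolding curve_ring_def FactRing_def by (auto simp: A_RCOSETS_def')
  show ?thesis
  proof (unfold_locales)
    show "\<psi> (x \<oplus>\<^bsub>?A\<^esub> y) = \<psi> x + \<psi> y" if "x \<in> carrier ?A" "y \<in> carrier ?A" for x y
      using ring_hom_add[OF hom that] by (simp add: mpoly_ring_def)
    show "\<psi> (x \<otimes>\<^bsub>?A\<^esub> y) = \<psi> x * \<psi> y" if "x \<in> carrier ?A" "y \<in> carrier ?A" for x y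
      using ring_hom_mult[OF hom that] by (simp add: mpoly_ring_def)
    show "\<psi> \<one>\<^bsub>?A\<^esub> = 1"
      using ring_hom_one[OF hom] by (simp add: mpoly_ring_def)
    show "bij_betw \<psi> (carrier ?A) sring"
      using inj image by (simp add: bij_betw_def)
    show "curve_ring_grading n m d = {x \<in> carrier ?A. \<forall>s\<in>Poly_Mapping.keys (\<psi> x). int (curve_degree (m n) s) = d}" for d
    proof (intro equalityI subsetI)
      fix x :: "'k mpoly set" assume "x \<in> curve_ring_grading n m d"
      then obtain p where p: "p \<in> mpoly_grading (Suc n) d" "x = ?I +>\<^bsub>R\<^esub> p"
        by (auto simp: curve_ring_grading_def quot_grading_def)
      then have pR: "p \<in> carrier R"
        by (simp add: mpoly_grading_def)
      have "int (curve_degree (m n) s) = d" if "s \<in> Poly_Mapping.keys (h p)" for s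
      proof -
        from that have "s \<in> (\<Union>t\<in>Poly_Mapping.keys p. Poly_Mapping.keys (Poly_Mapping.single (\<epsilon> t) (Poly_Mapping.lookup p t)))"
          unfolding h_eq[OF pR finite_keys order.refl] by (rule subsetD[OF Poly_Mapping.keys_sum])
        then obtain t where t: "t \<in> Poly_Mapping.keys p" "s = \<epsilon> t"
          by (auto split: if_splits)
        moreover have "Poly_Mapping.keys t \<subseteq> {Suc 0..Suc n}"
          using t pR by (auto simp: mpoly_ring_def)
        moreover have "int (monom_degree t) = d"
          using p t by (auto simp: mpoly_grading_def)
        ultimately show ?thesis
          by (simp add: degree_\<epsilon> dsum_monom_degree)
      qed
      then show "x \<in> {x \<in> carrier ?A. \<forall>s\<in>Poly_Mapping.keys (\<psi> x). int (curve_degree (m n) s) = d}"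
        using pR coset_A psi_coset p(2) by auto
    next
      fix x assume "x \<in> {x \<in> carrier ?A. \<forall>s\<in>Poly_Mapping.keys (\<psi> x). int (curve_degree (m n) s) = d}"
      then have x: "x \<in> carrier ?A" "\<And>s. s \<in> Poly_Mapping.keys (\<psi> x) \<Longrightarrow> int (curve_degree (m n) s) = d"
        by auto
      have "\<exists>p\<in>mpoly_grading (Suc n) d. h p = \<psi> x"
      \<comment> \<open>\<open>d\<close> may be negative, where only zero is homogeneous; a nonzero
        image shows that \<open>d\<close> is a natural number.\<close>
      proof (cases "\<psi> x = 0")
        case True
        have "(0 :: 'k mpoly) \<in> mpoly_grading (Suc n) d" "h (0 :: 'k mpoly) = 0"
          by (auto simp: mpoly_grading_def mpoly_ring_def mpoly_subst_def)
        with True show ?thesis by metis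
      next
        case False
        then obtain s where "s \<in> Poly_Mapping.keys (\<psi> x)"
          by (metis ex_in_conv keys_eq_empty)
        then have "d = int (nat d)"
          using x(2)[of s] by auto
        then show ?thesis
          using h_graded_preimage[of "\<psi> x" "nat d"] x image by fastforce
      qed
      then obtain p where p: "p \<in> mpoly_grading (Suc n) d" "h p = \<psi> x"
        by blast
      then have pR: "p \<in> carrier R"
        by (simp add: mpoly_grading_def)
      have "x = ?I +>\<^bsub>R\<^esub> p"
        using inj_onD[OF inj _ x(1) coset_A[OF pR]] psi_coset[OF pR] p by simp
      with p show "x \<in> curve_ring_grading n m d"
        by (auto simp: curve_ring_grading_def quot_grading_def)
    qed
  qed
qed

end


section \<open>The classification\<close>

context monomial_curve
begin

lemma koszul_if_koszul_flag:
  assumes "koszul_flag weights ws cs"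
  shows "koszul_algebra (curve_ring n m :: 'k::field mpoly set ring) (curve_ring_grading n m)"
  using semigroup_algebra.koszul_filtration_imp_koszul[OF semigroup_algebra_curve koszul_flag_filtration[OF assms]] .

text \<open>Here \<open>w\<close> has degree \<open>d + 3\<close>: the complement of one weight has
  degree \<open>d + 2\<close>, that of a pair \<open>d + 1\<close>.\<close>

lemma koszul_imp_sums_connected:
  assumes koszul: "koszul_algebra (curve_ring n m :: 'k::field mpoly set ring) (curve_ring_grading n m)"
    and P: "P \<subseteq> weights"
    and closed: "\<And>i j w'. i \<in> P \<Longrightarrow> j \<in> weights \<Longrightarrow> sums weights w' (Suc d) \<Longrightarrow> w = i + j + w' \<Longrightarrow> j \<in> P"
    and p: "p \<in> P" "sums weights w1 (Suc (Suc d))" "w = p + w1"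
    and q: "q \<in> weights" "sums weights w2 (Suc (Suc d))" "w = q + w2"
  shows "q \<in> P"
proof (rule semigroup_algebra.koszul_imp_connected[OF semigroup_algebra_curve koszul])
  let ?s = "point (m n) w (Suc (Suc (Suc d)))"
  have w: "sums weights w (Suc (Suc (Suc d)))"
    using sums_Suc[OF q(1,2)] q(3) by simp
  show "3 \<le> curve_degree (m n) ?s"
    by (simp add: curve_degree_point[OF m_pos sums_le[OF w]])
  show "P \<subseteq> weights" by fact
  show "j \<in> P" if ij: "i \<in> P" "j \<in> weights" and t: "t \<in> curve_semigroup (m n) weights"
    and eq: "?s = point (m n) i (Suc 0) + point (m n) j (Suc 0) + t" for i j t
  proof -
    obtain w' d' where wd: "sums weights w' d'" "t = point (m n) w' d'"
      using t unfolding curve_semigroup_def by blast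
    have i: "i \<in> weights"
      using ij P by blast
    have "point (m n) i (Suc 0) + point (m n) j (Suc 0) + t = point (m n) (i + j + w') (Suc (Suc d'))"
      unfolding wd(2) sums_point_add[OF sums_single[OF i, unfolded One_nat_def] sums_single[OF ij(2), unfolded One_nat_def]]
      using sums_point_add[OF sums_Suc[OF i sums_single[OF ij(2), unfolded One_nat_def]] wd(1)] by simp
    moreover have "sums weights (i + j + w') (Suc (Suc d'))"
      using sums_Suc[OF i sums_Suc[OF ij(2) wd(1)]] by (simp add: add.assoc)
    ultimately have "w = i + j + w' \<and> Suc (Suc (Suc d)) = Suc (Suc d')"
      using eq point_eq_iff[OF sums_le[OF w] sums_le m_pos] by metis
    with closed ij wd show ?thesis by blast
  qed
  show "p \<in> P" by fact
  show "point (m n) w1 (Suc (Suc d)) \<in> curve_semigroup (m n) weights"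
    by (rule point_in[OF p(2)])
  show "?s = point (m n) p (Suc 0) + point (m n) w1 (Suc (Suc d))"
    using sums_point_add[OF sums_single p(2), of p] p P by auto
  show "q \<in> weights" by fact
  show "point (m n) w2 (Suc (Suc d)) \<in> curve_semigroup (m n) weights"
    by (rule point_in[OF q(2)])
  show "?s = point (m n) q (Suc 0) + point (m n) w2 (Suc (Suc d))"
    using sums_point_add[OF sums_single q(2), of q] q by auto
qed

lemma koszul_imp_quadratic_relation:
  assumes koszul: "koszul_algebra (curve_ring n m :: 'k::field mpoly set ring) (curve_ring_grading n m)"
    and a: "a \<in> weights" "0 < a" "a < m n" and n: "n \<ge> 1"
  shows "\<exists>j\<in>weights - {a}. \<exists>l\<in>weights - {a}. 2 * a = j + l"
proof -
  \<comment> \<open>Off by one: \<open>rel k\<close> concerns the multiple \<open>Suc k * a\<close>,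
    with \<open>w\<close> collecting the \<open>k\<close> weights besides \<open>j\<close>.\<close>
  define rel where "rel k \<longleftrightarrow> (\<exists>j\<in>weights - {a}. \<exists>w. sums weights w k \<and> Suc k * a = j + w)" for k
  have mult: "sums weights (k * x) k" if "x \<in> weights" for k x
    using that by (induction k) (auto intro: sums_0 sums_Suc)
  have mn: "m n \<in> weights" "0 \<in> weights"
    using n by (auto simp: weights_def)
  \<comment> \<open>A relation always exists: \<open>m n\<close> copies of \<open>a\<close> have the
    same sum as \<open>a\<close> copies of \<open>m n\<close> and \<open>m n - a\<close> copies of
    0.\<close>
  have "rel (m n - 1)"
    unfolding rel_def
  proof (intro bexI exI conjI)
    have "sums weights ((a - 1) * m n + (m n - a) * 0) ((a - 1) + (m n - a))"
      by (intro sums_add mult mn)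
    moreover have "(a - 1) + (m n - a) = m n - 1"
      using a by simp
    ultimately show "sums weights ((a - 1) * m n) (m n - 1)"
      by simp
    show "Suc (m n - 1) * a = m n + (a - 1) * m n"
      using a by (cases a) (auto simp: algebra_simps)
    show "m n \<in> weights - {a}"
      using a mn by simp
  qed
  then obtain k where k: "rel k" "\<And>k'. k' < k \<Longrightarrow> \<not> rel k'"
    by (metis exists_least_iff)
  then obtain j w where j: "j \<in> weights" "j \<noteq> a" "sums weights w k" "Suc k * a = j + w"
    by (auto simp: rel_def)
  consider "k = 0" | "k = 1" | d where "k = Suc (Suc d)"
    by (metis One_nat_def not0_implies_Suc)
  then show ?thesis
  proof cases
    case 1
    with j show ?thesis by (simp add: sums_deg_0)
  next
    case 2
    with j have "w \<in> weights"
      using sums_deg_1 by blast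
    with 2 j show ?thesis
      by (intro bexI[of _ j] bexI[of _ w]) auto
  next
    case 3
    have "j \<in> {a}"
    proof (rule koszul_imp_sums_connected[OF koszul])
      show "{a} \<subseteq> weights" "a \<in> {a}" "j \<in> weights"
        using a j by auto
      show "j' \<in> {a}" if "i \<in> {a}" "j' \<in> weights" "sums weights w' (Suc d)" "Suc k * a = i + j' + w'" for i j' w'
      \<comment> \<open>Cancelling \<open>i = a\<close> would leave a second factorization of
        \<open>k * a\<close>, against the minimality of \<open>k\<close>; hence \<open>{a}\<close>
        is closed.\<close>
      proof (rule ccontr)
        assume "j' \<notin> {a}"
        with that 3 have "rel (Suc d)"
          unfolding rel_def by (intro bexI[of _ j'] exI[of _ w']) auto
        with k(2) 3 show False by simp
      qed
      show "sums weights (k * a) (Suc (Suc d))" "sums weights w (Suc (Suc d))"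
        using mult[OF a(1), of k] j 3 by auto
      show "Suc k * a = a + k * a" "Suc k * a = j + w"
        using j by auto
    qed
    with j show ?thesis by simp
  qed
qed

end

text \<open>In terms of the successive differences \<open>p\<close>, \<open>q\<close>,
  \<open>r\<close> the relations become short homogeneous equations. They determine the weights up
  to scaling, and the gcd condition fixes the scale.\<close>

lemma quadratic_weights:
  fixes a b c e :: nat
  assumes "0 < a" "a < b" "b < c" "c < e"
    and "2 * a \<in> {b, c, e}" "2 * b \<in> {c, e, a + c, a + e}" "2 * c \<in> {e, a + e, b + e}"
    and "Gcd {a, b, c, e} = 1"
  shows "(a, b, c, e) \<in> {(1, 2, 3, 4), (1, 2, 3, 5), (1, 2, 3, 6), (1, 2, 4, 6), (1, 2, 4, 7), (1, 2, 4, 8), (2, 3, 4, 5), (2, 3, 4, 6), (2, 3, 4, 8), (2, 4, 5, 6), (2, 4, 5, 8), (3, 4, 5, 6), (3, 4, 6, 8), (3, 5, 6, 7), (4, 5, 6, 8), (4, 6, 7, 8)}"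
proof -
  obtain p q r where pqr: "b = a + p" "c = a + p + q" "e = a + p + q + r" "0 < p" "0 < q" "0 < r"
    using assms(2-4) by (metis less_imp_add_positive)
  have gcd: "g = 1" if "g dvd a" "g dvd b" "g dvd c" "g dvd e" for g
    using assms(8) that by (metis Gcd_greatest empty_iff insert_iff nat_dvd_1_iff_1)
  have h1: "p = a \<or> a = p + q \<or> a = p + q + r"
    using assms(5) unfolding pqr(1-3) by auto
  have h2: "a + p = q \<or> a + p = q + r \<or> p = q \<or> p = q + r"
    using assms(6) unfolding pqr(1-3) by auto
  have h3: "a + p + q = r \<or> p + q = r \<or> q = r"
    using assms(7) unfolding pqr(1-3) by auto
  \<comment> \<open>Of the 3 * 4 * 3 choices of equations, positivity leaves these sixteen rays.
    Each is written in multiples of one number, which then divides all four weights and equals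
    1.\<close>
  have "(p = 1 * a \<and> q = 1 * a \<and> r = 1 * a) \<or>
      (p = 1 * a \<and> q = 1 * a \<and> r = 2 * a) \<or>
      (p = 1 * a \<and> q = 1 * a \<and> r = 3 * a) \<or>
      (p = 1 * a \<and> q = 2 * a \<and> r = 2 * a) \<or>
      (p = 1 * a \<and> q = 2 * a \<and> r = 3 * a) \<or>
      (p = 1 * a \<and> q = 2 * a \<and> r = 4 * a) \<or>
      (a = 2 * p \<and> q = 1 * p \<and> r = 1 * p) \<or>
      (a = 2 * p \<and> q = 1 * p \<and> r = 2 * p) \<or>
      (a = 2 * p \<and> q = 1 * p \<and> r = 4 * p) \<or>
      (a = 2 * q \<and> p = 2 * q \<and> r = 1 * q) \<or>
      (a = 2 * q \<and> p = 2 * q \<and> r = 3 * q) \<or>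
      (a = 3 * p \<and> q = 1 * p \<and> r = 1 * p) \<or>
      (a = 3 * p \<and> q = 2 * p \<and> r = 2 * p) \<or>
      (a = 3 * q \<and> p = 2 * q \<and> r = 1 * q) \<or>
      (a = 4 * p \<and> q = 1 * p \<and> r = 2 * p) \<or>
      (a = 4 * q \<and> p = 2 * q \<and> r = 1 * q)"
    using h1 h2 h3 assms(1) pqr(4-6)
    by (elim disjE) ((rule disjI1, (intro conjI; linarith)) | rule disjI2 | (intro conjI; linarith))+
  then show ?thesis
    using gcd[of a] gcd[of p] gcd[of q] gcd[of r] unfolding pqr(1-3) by (elim disjE) auto
qed

theorem theorem4p4:
  fixes m :: "nat \<Rightarrow> nat"
  assumes "infinite (UNIV :: 'k::field set)"
    and "0 < m 1" "m 1 < m 2" "m 2 < m 3" "m 3 < m 4"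
    and "Gcd {m 1, m 2, m 3, m 4} = 1"
  shows "koszul_algebra (curve_ring 4 m :: 'k mpoly set ring) (curve_ring_grading 4 m) \<longleftrightarrow>
    {m 1, m 2, m 3, m 4} \<in>
      {{1, 2, 3, 4}, {1, 2, 3, 5}, {1, 2, 3, 6}, {1, 2, 4, 6}, {1, 2, 4, 8},
       {2, 3, 4, 5}, {2, 3, 4, 6}, {2, 3, 4, 8}, {2, 4, 5, 6}, {2, 4, 5, 8},
       {3, 4, 5, 6}, {3, 4, 6, 8}, {4, 5, 6, 8}, {4, 6, 7, 8}}"
    (is "?koszul \<longleftrightarrow> _ \<in> ?list")
proof -
  have idx: "{1..4} = {1, 2, 3, 4 :: nat}"
    by auto
  interpret monomial_curve 4 m
  proof
    show "m i \<le> m 4" if "i \<in> {1..4}" for i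
      using that assms unfolding idx by auto
  qed (use assms in simp)
  have weights: "weights = insert 0 {m 1, m 2, m 3, m 4}"
    unfolding weights_def idx by simp
  note lt = assms(2-5)
  show ?thesis
  proof
    assume "{m 1, m 2, m 3, m 4} \<in> ?list"
    then have "\<exists>ws cs. koszul_flag weights ws cs"
      unfolding weights
      by (elim insertE emptyE; simp only:)
        (use koszul_flag_1_2_3_4 koszul_flag_1_2_3_5 koszul_flag_1_2_3_6 koszul_flag_1_2_4_6 koszul_flag_1_2_4_8 koszul_flag_2_3_4_5 koszul_flag_2_3_4_6 koszul_flag_2_3_4_8 koszul_flag_2_4_5_6 koszul_flag_2_4_5_8 koszul_flag_3_4_5_6 koszul_flag_3_4_6_8 koszul_flag_4_5_6_8 koszul_flag_4_6_7_8 in \<open>simp only: insert_commute, blast\<close>)+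
    then show ?koszul
      using koszul_if_koszul_flag by blast
  next
    assume koszul: ?koszul
    note rel = koszul_imp_quadratic_relation[OF koszul, unfolded weights]
    \<comment> \<open>All other positive weights exceed \<open>m 1\<close>, so one summand must be
      0. The order restricts the two remaining relations similarly.\<close>
    have "2 * m 1 \<in> {m 2, m 3, m 4}"
      using rel[of "m 1"] lt by auto
    moreover have "2 * m 2 \<in> {m 3, m 4, m 1 + m 3, m 1 + m 4}"
      using rel[of "m 2"] lt by auto
    moreover have "2 * m 3 \<in> {m 4, m 1 + m 4, m 2 + m 4}"
      using rel[of "m 3"] lt by auto
    ultimately have cases: "(m 1, m 2, m 3, m 4) \<in> {(1, 2, 3, 4), (1, 2, 3, 5), (1, 2, 3, 6), (1, 2, 4, 6), (1, 2, 4, 7), (1, 2, 4, 8), (2, 3, 4, 5), (2, 3, 4, 6), (2, 3, 4, 8), (2, 4, 5, 6), (2, 4, 5, 8), (3, 4, 5, 6), (3, 4, 6, 8), (3, 5, 6, 7), (4, 5, 6, 8), (4, 6, 7, 8)}"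
      using lt assms(6) by (intro quadratic_weights)
    \<comment> \<open>The exclusions take place in degree 3, where the complement of a pair is a
      single weight and closedness of \<open>P\<close> is a finite check.\<close>
    have conn: "q \<in> P" if "P \<subseteq> weights" "\<forall>i\<in>P. \<forall>j\<in>weights. \<forall>l\<in>weights. w = i + j + l \<longrightarrow> j \<in> P"
      "p \<in> P" "p' \<in> weights" "p'' \<in> weights" "w = p + p' + p''"
      "q \<in> weights" "q' \<in> weights" "q'' \<in> weights" "w = q + q' + q''" for P w p p' p'' q q' q''
    proof (rule koszul_imp_sums_connected[OF koszul, where w = w and d = 0])
      show "j \<in> P" if "i \<in> P" "j \<in> weights" "sums weights w' (Suc 0)" "w = i + j + w'" for i j w'
        using that \<open>\<forall>i\<in>P. _\<close> sums_deg_1[of weights w'] by simp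
      show "sums weights (p' + p'') (Suc (Suc 0))" "sums weights (q' + q'') (Suc (Suc 0))"
        using that sums_Suc[OF _ sums_single] by auto
    qed (use that in auto)
    have "(m 1, m 2, m 3, m 4) \<noteq> (1, 2, 4, 7)"
    proof
      assume "(m 1, m 2, m 3, m 4) = (1, 2, 4, 7)"
      then have W: "weights = {0, 1, 2, 4, 7}"
        by (simp add: weights)
      have "1 \<in> {0, 7 :: nat}"
        by (rule conn[of "{0, 7}" 7 0 0 7 1 2 4]) (simp_all add: W)
      then show False
        by simp
    qed
    moreover have "(m 1, m 2, m 3, m 4) \<noteq> (3, 5, 6, 7)"
    proof
      assume "(m 1, m 2, m 3, m 4) = (3, 5, 6, 7)"
      then have W: "weights = {0, 3, 5, 6, 7}"
        by (simp add: weights)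
      have "3 \<in> {0, 7 :: nat}"
        by (rule conn[of "{0, 7}" 14 0 7 7 3 5 6]) (simp_all add: W)
      then show False
        by simp
    qed
    ultimately show "{m 1, m 2, m 3, m 4} \<in> ?list"
      using cases by (elim insertE emptyE) simp_all
  qed
qed

end
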